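(* Let $k\in\mathbb C$ with $\Re(k)>0$, let $\vartheta$ be a root of unity, and let $f:\mathbb Q\to\mathbb C$ and $h:\mathbb R\setminus\{0\}\to\mathbb C$ satisfy $$f(x+1)=\vartheta f(x)\ \ (x\in\mathbb Q),\qquad h(x)=f(x)-\vartheta^{\pm3}|x|^{-k}f(-1/x)\ \ (\pm x\in\mathbb Q_{>0}).$$ For $x\in(0,1)$ irrational with $x=[0;b_1,b_2,\dots]$ set $$f^\ast(x):=\lim_{j\to\infty}\vartheta^{-3-\sum_{i=1}^{2j+1}(-1)^ib_i}\,\mathrm{den}(x_{2j+1})^{-k}f\big(\overline{x_{2j+1}}\big),$$ where $x_{2j+1}=[0;b_1,\dots,b_{2j+1}]$. Let $\phi:\mathbb C\to\mathbb R$ be an $\mathbb R$-linear form and assume that $h$ satisfies one of the following: (1* ) $h$ extends to a continuous function on $[-1,1]$, and either $\Im k=0$ and there exist $p\in\mathbb Z$ and $\alpha\in(-1,1)$ with $\phi(\vartheta^ph(\alpha))\neq0$; or $\Im k\neq0$ and there exists $\alpha\in(-1,1)$ with $h(\alpha)\neq0$. (2* ) For some choice of sign $\pm$ one has $\lim_{x\to0^\pm}|h(x)|=\infty$; there exists $\delta\in(0,1)$ with $h(x)\ll e^{|x|^{-1+\delta}}$ for $0<|x|\leq1$; and either $\Im k=0$ and there exists $p\in\mathbb Z$ such that for all sufficiently small $\varepsilon>0$, $$\liminf_{x\to0^\pm}\inf\Big\{\Big|\phi\Big(\vartheta^p\frac{h(x)-u^kh(ux)}{|h(x)|}\Big)\Big|\colon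 u>0,\ |\log u|\in(\varepsilon,\varepsilon^{2/3})\Big\}>0,$$ or $\Im k\neq0$ and there exists $\beta\in\mathbb R$ such that for all sufficiently small $\varepsilon>0$, $$\liminf_{x\to0^\pm}\inf\Big\{\Big|\phi\Big(e(\alpha)\frac{h(x)-u^kh(ux)}{|h(x)|}\Big)\Big|\colon u>0,\ |\log u|\in(\varepsilon,\varepsilon^{2/3}),\ \alpha\in\mathbb R,\ |\alpha-\beta|<\varepsilon^{2/3}\Big\}>0.$$ Then the limit defining $f^\ast$ exists for almost every $x\in(0,1)$, and the cumulative distribution function of $(\phi\circ f^\ast)_\ast(\nu)$ is continuous, where $\nu$ is Lebesgue measure on $[0,1]$.
   Context: $e(\alpha)=e^{2\pi i\alpha}$. $\mathrm{den}(y)$ is the denominator of a rational $y$; for $y=a/q$ reduced, $\overline y=\overline a_q/q$ with $\overline a_q\in(0,q]$, $a\overline a_q\equiv1\pmod q$. In (2* ) the same sign $\pm$ is used throughout.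
   Formalization: The linear form φ is assumed to be nonzero; for φ = 0 condition (1* ) with Im k ≠ 0 can hold, but the pushforward is then a point mass at 0 and its distribution function is not continuous. *)

theory Defs
  imports "HOL-Probability.Distribution_Functions"
begin

definition gauss_map :: "real \<Rightarrow> real" where
  "gauss_map x = frac (1 / x)"

definition cf_digit :: "real \<Rightarrow> nat \<Rightarrow> int" where
  "cf_digit x i = \<lfloor>1 / ((gauss_map ^^ (i - 1)) x)\<rfloor>"

text \<open>cf_tail b m n = [0; b_(m+1), ..., b_(m+n)].\<close>
fun cf_tail :: "(nat \<Rightarrow> int) \<Rightarrow> nat \<Rightarrow> nat \<Rightarrow> rat" where
  "cf_tail b m 0 = 0"
| "cf_tail b m (Suc n) = 1 / (of_int (b (Suc m)) + cf_tail b (Suc m) n)"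

definition cf_conv :: "real \<Rightarrow> nat \<Rightarrow> rat" where
  "cf_conv x n = cf_tail (cf_digit x) 0 n"

definition rden :: "rat \<Rightarrow> int" where
  "rden y = snd (quotient_of y)"

definition rbar :: "rat \<Rightarrow> rat" where
  "rbar y = (case quotient_of y of (a, q) \<Rightarrow>
     of_int (THE c. 0 < c \<and> c \<le> q \<and> (a * c) mod q = 1 mod q) / of_int q)"

definition fstar_seq :: "(rat \<Rightarrow> complex) \<Rightarrow> complex \<Rightarrow> complex \<Rightarrow> real \<Rightarrow> nat \<Rightarrow> complex" where
  "fstar_seq f \<theta> k x j =
     \<theta> powi (-3 - (\<Sum>i=1..2*j+1. (-1)^i * cf_digit x i))
     * (of_int (rden (cf_conv x (2*j+1))) :: complex) powr (-k)
     * f (rbar (cf_conv x (2*j+1)))"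

text \<open>f*(x): the limit when it exists (0 otherwise; this only matters on a null set).\<close>
definition fstar :: "(rat \<Rightarrow> complex) \<Rightarrow> complex \<Rightarrow> complex \<Rightarrow> real \<Rightarrow> complex" where
  "fstar f \<theta> k x = (if convergent (fstar_seq f \<theta> k x) then lim (fstar_seq f \<theta> k x) else 0)"

definition e1 :: "real \<Rightarrow> complex" where
  "e1 \<alpha> = exp (2 * of_real pi * \<i> * of_real \<alpha>)"

end

theory Submission
  imports Defs
begin

text \<open>
  By the reciprocity relations, the approximants of \<open>f\<^sup>*(x)\<close> telescope to partial sums of
  \<open>f(0) + \<Sum>\<^sub>n c\<^sub>n h(\<plusminus>y\<^sub>n)\<close>, where \<open>y\<^sub>n = q\<^sub>n\<^sub>-\<^sub>1/q\<^sub>n = [0; b\<^sub>n, \<dots>, b\<^sub>1]\<close>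
  and \<open>c\<^sub>n\<close> is \<open>q\<^sub>n\<^sup>-\<^sup>k\<close> times a power of \<open>\<theta>\<close>. Since \<open>q\<^sub>n\<close> grows exponentially, the series converges
  absolutely whenever the digits grow at most like \<open>n\<^sup>1\<^sup>+\<^sup>\<delta>\<close>, hence almost surely.

  If a level set \<open>E\<close> of \<open>\<phi> \<circ> f\<^sup>*\<close> had positive measure, some cylinder \<open>u\<close> would be filled by \<open>E\<close> up to an
  arbitrarily small proportion. So for any prescribed finite set of words \<open>w\<close>, every cylinder \<open>u w\<close> contains
  a point of \<open>E\<close> whose digits after \<open>u w\<close> are slow, which bounds the normalised tail of its series by a
  constant. Under (1*), following \<open>v\<close> by a huge digit shows that the normalised residual at \<open>v\<close> is tiny, so
  every term \<open>\<phi>(c h(\<plusminus>y))/|c|\<close> of bounded last digit is tiny; a suitable \<open>w\<close> steers \<open>\<plusminus>y\<close> close to \<open>\<alpha>\<close> and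
  the phase of \<open>c\<close> to one where \<open>\<phi>\<close> does not vanish. Under (2*), two large last digits \<open>d \<equiv> d'\<close> modulo the
  order of \<open>\<theta>\<close> give two values whose difference is bounded, but which dominates \<open>|h(x)|\<close> by hypothesis.
\<close>

section \<open>Continued fractions\<close>

text \<open>The word \<open>u\<close> obtained from a positive level set is not under control: the
  parity of its length, its denominator and the phase of its coefficient are unknown. Whatever is to
  follow it must be listed in a finite set beforehand, with a suitable entry for every possible
  \<open>u\<close>. This works because the past acts only through a sign, a scalar coefficient and
  one number y in [0,1], the reversed fraction. Hence denominators, coefficients and partial sums
  are defined relative to a sign and a base point y and obey cocycle identities, and the tail bound
  is uniform in both. Parity, phase and position are each corrected by digits from a bounded range,
  uniformly in y; dividing by the modulus of the coefficient removes the unknown scale. Bounded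
  distortion of the inverse branches, with constant 4, plays the role of independence of
  digits.\<close>

definition cf_step :: "int \<Rightarrow> 'a::field_char_0 \<Rightarrow> 'a" where
  "cf_step d y = 1 / (of_int d + y)"

text \<open>For \<open>w = [b\<^sub>1, \<dots>, b\<^sub>n]\<close>: \<open>cf_val w z = [0; b\<^sub>1, \<dots>, b\<^sub>n + z]\<close> and
  \<open>cf_rev w y = [0; b\<^sub>n, \<dots>, b\<^sub>1 + y]\<close>, while \<open>cf_den 0 w\<close> is the denominator \<open>q\<^sub>n\<close> of \<open>[0; b\<^sub>1, \<dots>, b\<^sub>n]\<close>.\<close>

abbreviation cf_val :: "int list \<Rightarrow> 'a::field_char_0 \<Rightarrow> 'a" where
  "cf_val w z \<equiv> foldr cf_step w z"

abbreviation cf_rev :: "int list \<Rightarrow> 'a::field_char_0 \<Rightarrow> 'a" where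
  "cf_rev w y \<equiv> fold cf_step w y"

definition word :: "int list \<Rightarrow> bool" where
  "word w \<longleftrightarrow> (\<forall>d\<in>set w. 1 \<le> d)"

fun cf_den :: "real \<Rightarrow> int list \<Rightarrow> real" where
  "cf_den y [] = 1"
| "cf_den y (d # w) = (of_int d + y) * cf_den (cf_step d y) w"

lemma word_Nil [simp]: "word []"
  and word_Cons [simp]: "word (d # w) \<longleftrightarrow> 1 \<le> d \<and> word w"
  and word_append [simp]: "word (v @ w) \<longleftrightarrow> word v \<and> word w"
  and word_rev [simp]: "word (rev w) \<longleftrightarrow> word w"
  by (auto simp: word_def)

lemma cf_step_pos: "1 \<le> d \<Longrightarrow> 0 \<le> y \<Longrightarrow> 0 < cf_step d (y::real)"
  by (simp add: cf_step_def)

lemma cf_step_le1: "1 \<le> d \<Longrightarrow> 0 \<le> y \<Longrightarrow> cf_step d (y::real) \<le> 1"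
  by (simp add: cf_step_def divide_simps)

lemma cf_rev_unit: "word w \<Longrightarrow> 0 \<le> y \<Longrightarrow> y \<le> 1 \<Longrightarrow> 0 \<le> cf_rev w (y::real) \<and> cf_rev w y \<le> 1"
  by (induction w arbitrary: y) (auto simp: cf_step_le1 cf_step_pos less_imp_le)

lemma cf_val_rev: "cf_val w = cf_rev (rev w)"
  by (simp add: foldr_conv_fold)

lemma cf_step_of_rat: "cf_step d (of_rat y :: real) = of_rat (cf_step d y)"
  by (simp add: cf_step_def of_rat_divide of_rat_add)

lemma cf_rev_of_rat: "cf_rev w (of_rat y :: real) = of_rat (cf_rev w y)"
  by (induction w arbitrary: y) (auto simp: cf_step_of_rat)

text \<open>Cocycle identity: reading \<open>v\<close> moves the base point from y to
  \<open>cf_rev v y\<close>, where the factors of \<open>w\<close> start.\<close>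

lemma cf_den_append: "cf_den y (v @ w) = cf_den y v * cf_den (cf_rev v y) w"
  by (induction v arbitrary: y) (auto simp: mult.assoc)

lemma cf_den_ge1: "word w \<Longrightarrow> 0 \<le> y \<Longrightarrow> 1 \<le> cf_den y w"
proof (induction w arbitrary: y)
  case (Cons d w)
  have "1 * 1 \<le> (of_int d + y) * cf_den (cf_step d y) w"
    using Cons by (intro mult_mono) (auto simp: cf_step_pos less_imp_le)
  then show ?case by simp
qed simp

text \<open>Two consecutive digits contribute (d + y)(e + 1/(d + y)) = e(d + y) + 1, at least 2 for
  every base point; hence the induction in steps of two.\<close>

lemma cf_den_growth: "word w \<Longrightarrow> 0 \<le> y \<Longrightarrow> 2 ^ (length w div 2) \<le> cf_den y w"
proof (induction w arbitrary: y rule: induct_list012)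
  case (2 d)
  then show ?case by simp
next
  case (3 d e w)
  let ?y = "cf_step e (cf_step d y)"
  have "2 ^ (length w div 2) \<le> cf_den ?y w"
    using 3 by (auto simp: cf_step_pos less_imp_le)
  moreover have "(2::real) \<le> (of_int d + y) * (of_int e + cf_step d y)"
  proof -
    have "1 * 1 \<le> of_int e * (of_int d + y)"
      using 3 by (intro mult_mono) auto
    moreover have "of_int d + y > 0" using 3 by auto
    ultimately show ?thesis
      by (auto simp: cf_step_def algebra_simps)
  qed
  ultimately have "2 * 2 ^ (length w div 2) \<le> ((of_int d + y) * (of_int e + cf_step d y)) * cf_den ?y w"
    by (intro mult_mono) auto
  then show ?case by (simp add: mult.assoc)
qed simp

text \<open>Isolates a digit put in front of \<open>w\<close>: with base point 1/(d + y) the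
  denominator of \<open>d # w\<close> becomes A(d + y + B/A), a constant times a bounded shift of
  d.\<close>

lemma cf_den_affine: "word w \<Longrightarrow> \<exists>A B. 1 \<le> A \<and> 0 \<le> B \<and> (\<forall>y\<ge>0. cf_den y w = A + B * y)"
proof (induction w)
  case Nil
  show ?case by (rule exI[of _ 1], rule exI[of _ 0]) auto
next
  case (Cons d w)
  then obtain A B where AB: "1 \<le> A" "0 \<le> B" "\<And>y. y \<ge> 0 \<Longrightarrow> cf_den y w = A + B * y" by auto
  have "1 * 1 \<le> A * of_int d" using AB Cons by (intro mult_mono) auto
  moreover have "cf_den y (d # w) = (A * of_int d + B) + A * y" if "y \<ge> 0" for y
  proof -
    have "of_int d + y > 0" using that Cons by auto
    then show ?thesis using AB(3)[of "cf_step d y"] that Cons.prems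
      by (simp add: cf_step_pos less_imp_le) (simp add: cf_step_def field_simps)
  qed
  ultimately show ?case using AB by (intro exI[of _ "A * of_int d + B"] exI[of _ A]) auto
qed

text \<open>The recursion of convergents, p'/q' being the one before p/q: appending d replaces q by
  q d + q', which is why the induction works at the end of the word. Real and rational values are
  both recorded, since measure theory needs the former and \<open>f\<close> the latter.\<close>

lemma cf_matrix:
  assumes "word w"
  shows "\<exists>p p' q q' :: int. 1 \<le> q \<and> 0 \<le> q' \<and> q' \<le> q \<and> (w \<noteq> [] \<longrightarrow> 1 \<le> q')
     \<and> p * q' - p' * q = - ((-1) ^ length w)
     \<and> (\<forall>z::real. 0 \<le> z \<longrightarrow> cf_val w z = (of_int p + of_int p' * z) / (of_int q + of_int q' * z))
     \<and> cf_val w 0 = (of_int p / of_int q :: rat)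
     \<and> cf_rev w 0 = (of_int q' / of_int q :: rat)
     \<and> cf_den 0 w = of_int q"
  using assms
proof (induction w rule: rev_induct)
  case Nil
  show ?case
    by (rule exI[of _ 0], rule exI[of _ 1], rule exI[of _ 1], rule exI[of _ 0]) auto
next
  case (snoc d w)
  then obtain p p' q q' :: int where
    a: "1 \<le> q" "0 \<le> q'" "q' \<le> q" "p * q' - p' * q = - ((-1) ^ length w)"
    and v: "\<And>z::real. 0 \<le> z \<Longrightarrow> cf_val w z = (of_int p + of_int p' * z) / (of_int q + of_int q' * z)"
    and r: "cf_rev w 0 = (of_int q' / of_int q :: rat)"
    and dn: "cf_den 0 w = of_int q"
    by auto
  have d: "1 \<le> d" using snoc by auto
  define Q where "Q = q * d + q'"
  have "q * 1 \<le> q * d" using a d by (intro mult_left_mono) auto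
  then have Q: "1 \<le> Q" "q \<le> Q"
    using a unfolding Q_def by linarith+
  have vz: "cf_val (w @ [d]) z = (of_int (p * d + p') + of_int p * z) / (of_int Q + of_int q * z)"
    if z: "0 \<le> z" for z :: real
  proof -
    have dz: "of_int d + z > 0" using d z by auto
    have "cf_val (w @ [d]) z = cf_val w (1 / (of_int d + z))" by (simp add: cf_step_def)
    also have "\<dots> = (of_int p + of_int p' * (1 / (of_int d + z))) / (of_int q + of_int q' * (1 / (of_int d + z)))"
      by (rule v) (use dz in auto)
    also have "\<dots> = ((of_int p * (of_int d + z) + of_int p') / (of_int d + z)) / ((of_int q * (of_int d + z) + of_int q') / (of_int d + z))"
      using dz by (simp add: field_simps)
    also have "\<dots> = (of_int p * (of_int d + z) + of_int p') / (of_int q * (of_int d + z) + of_int q')"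
      using dz by simp
    finally show ?thesis by (simp add: Q_def algebra_simps)
  qed
  have "real_of_rat (cf_val (w @ [d]) 0) = real_of_rat (of_int (p * d + p') / of_int Q)"
    using vz[of 0] cf_rev_of_rat[of "rev (w @ [d])" 0]
    by (simp add: cf_val_rev of_rat_divide of_rat_add of_rat_mult)
  then have v0: "cf_val (w @ [d]) 0 = (of_int (p * d + p') / of_int Q :: rat)"
    by (simp only: of_rat_eq_iff)
  have "(of_int q :: rat) \<noteq> 0" using a by auto
  then have r': "cf_rev (w @ [d]) 0 = (of_int q / of_int Q :: rat)"
    by (simp add: r cf_step_def Q_def field_simps)
  have "cf_rev w 0 = (of_int q' / of_int q :: real)"
    using cf_rev_of_rat[of w 0] by (simp add: r of_rat_divide)
  moreover have "(of_int q :: real) \<noteq> 0" using a by auto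
  ultimately have dn': "cf_den 0 (w @ [d]) = of_int Q"
    by (simp add: cf_den_append dn Q_def field_simps)
  have det: "(p * d + p') * q - p * Q = - ((-1) ^ length (w @ [d]))"
    using a(4) by (simp add: Q_def algebra_simps)
  show ?case
    by (rule exI[of _ "p * d + p'"], rule exI[of _ p], rule exI[of _ Q], rule exI[of _ q])
      (use a Q vz v0 r' dn' det in auto)
qed

section \<open>Digit prefixes and the modular inverse of a convergent\<close>

definition cf_prefix :: "(nat \<Rightarrow> int) \<Rightarrow> nat \<Rightarrow> int list" where
  "cf_prefix b n = map b [0..<n]"

lemma length_cf_prefix [simp]: "length (cf_prefix b n) = n"
  by (simp add: cf_prefix_def)

lemma cf_prefix_Suc: "cf_prefix b (Suc n) = cf_prefix b n @ [b n]"
  by (simp add: cf_prefix_def)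

lemma cf_prefix_Suc': "cf_prefix b (Suc n) = b 0 # cf_prefix (\<lambda>i. b (Suc i)) n"
  unfolding cf_prefix_def by (simp add: upt_conv_Cons map_Suc_upt[symmetric] o_def del: upt_Suc)

lemma cf_tail_eq: "cf_tail b m n = cf_val (cf_prefix (\<lambda>i. b (m + Suc i)) n) 0"
proof (induction n arbitrary: m)
  case 0
  show ?case by (simp add: cf_prefix_def)
next
  case (Suc n)
  show ?case by (simp add: Suc cf_prefix_Suc' cf_step_def)
qed

text \<open>At odd length the determinant identity reads p q' = 1 + p' q, so q' inverts p modulo q
  and the barred convergent is the reversed fraction q'/q. This is where the odd indices of the
  limit enter.\<close>

lemma rden_rbar_cf_val:
  assumes w: "word w" and odd: "odd (length w)"
  shows "of_int (rden (cf_val w 0)) = cf_den 0 w" and "rbar (cf_val w 0) = cf_rev w 0"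
proof -
  obtain p p' q q' :: int where a: "1 \<le> q" "0 \<le> q'" "q' \<le> q" "1 \<le> q'"
    and det: "p * q' - p' * q = 1"
    and v: "cf_val w 0 = (of_int p / of_int q :: rat)"
    and r: "cf_rev w 0 = (of_int q' / of_int q :: rat)"
    and dn: "cf_den 0 w = of_int q"
    using cf_matrix[OF w] odd by (cases "w = []") auto
  have "coprime p q"
  proof (rule coprimeI)
    fix c assume "c dvd p" "c dvd q"
    then have "c dvd p * q' - p' * q" by (intro dvd_diff) auto
    then show "is_unit c" using det by simp
  qed
  then have "quotient_of (cf_val w 0) = (p, q)"
    using a by (subst v) (simp add: Fract_of_int_quotient[symmetric] quotient_of_Fract normalize_stable)
  moreover have "(THE c. 0 < c \<and> c \<le> q \<and> (p * c) mod q = 1 mod q) = q'"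
  proof (rule the_equality)
    have "p * q' = 1 + p' * q" using det by simp
    then show "0 < q' \<and> q' \<le> q \<and> (p * q') mod q = 1 mod q" using a by simp
  next
    fix c assume c: "0 < c \<and> c \<le> q \<and> (p * c) mod q = 1 mod q"
    have "p * q' = 1 + p' * q" using det by simp
    then have "(p * q') mod q = 1 mod q" by simp
    then have "(p * c) mod q = (p * q') mod q" using c by simp
    then have "q dvd p * c - p * q'" by (simp add: mod_eq_dvd_iff)
    then have "q dvd p * (c - q')" by (simp add: right_diff_distrib)
    then have "q dvd c - q'" using \<open>coprime p q\<close> by (simp add: coprime_dvd_mult_right_iff coprime_commute)
    moreover have "\<bar>c - q'\<bar> < q" using a c by auto
    ultimately show "c = q'" using zdvd_imp_le[of q "\<bar>c - q'\<bar>"] by (cases "c = q'") auto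
  qed
  ultimately show "of_int (rden (cf_val w 0)) = cf_den 0 w" "rbar (cf_val w 0) = cf_rev w 0"
    by (auto simp: rden_def rbar_def r dn)
qed

section \<open>Irrational points, the Gauss map and cylinders\<close>

definition irr :: "real set" where
  "irr = {x. 0 < x \<and> x < 1 \<and> x \<notin> \<rat>}"

text \<open>Digits are indexed from 0 here: \<open>dig x i\<close> is \<open>b\<^sub>i\<^sub>+\<^sub>1\<close>.\<close>

definition dig :: "real \<Rightarrow> nat \<Rightarrow> int" where
  "dig x i = cf_digit x (Suc i)"

lemma dig_0: "dig x 0 = \<lfloor>1 / x\<rfloor>"
  and dig_Suc: "dig x (Suc i) = dig (gauss_map x) i"
  by (simp_all add: dig_def cf_digit_def funpow_swap1)

lemma gauss_map_irr: assumes "x \<in> irr" shows "gauss_map x \<in> irr"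
proof -
  have "frac (1 / x) \<noteq> 0"
  proof
    assume "frac (1 / x) = 0"
    then have "1 / x \<in> \<int>" by (simp add: frac_eq_0_iff)
    then have "1 / x \<in> \<rat>" using Ints_subset_Rats by blast
    then have "inverse (1 / x) \<in> \<rat>" by (rule Rats_inverse)
    then show False using assms by (simp add: irr_def)
  qed
  then have "0 < frac (1 / x)" by (simp add: order_less_le)
  moreover have "frac (1 / x) \<notin> \<rat>"
  proof
    assume "frac (1 / x) \<in> \<rat>"
    then have "frac (1 / x) + of_int \<lfloor>1 / x\<rfloor> \<in> \<rat>" by (intro Rats_add) auto
    then have "1 / x \<in> \<rat>" by (simp add: frac_def)
    then have "inverse (1 / x) \<in> \<rat>" by (rule Rats_inverse)
    then show False using assms by (simp add: irr_def)
  qed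
  ultimately show ?thesis by (simp add: irr_def gauss_map_def frac_lt_1)
qed

lemma cf_step_irr: assumes "z \<in> irr" "1 \<le> d" shows "cf_step d z \<in> irr"
proof -
  have "of_int d + z > 1" using assms by (auto simp: irr_def)
  moreover have "1 / (of_int d + z) \<notin> \<rat>"
  proof
    assume "1 / (of_int d + z) \<in> \<rat>"
    then have "inverse (1 / (of_int d + z)) \<in> \<rat>" by (rule Rats_inverse)
    then have "(of_int d + z) - of_int d \<in> \<rat>" by (intro Rats_diff) auto
    then show False using assms by (simp add: irr_def)
  qed
  ultimately show ?thesis by (auto simp: irr_def cf_step_def)
qed

lemma cf_step_gauss: assumes "x \<in> irr" shows "cf_step \<lfloor>1 / x\<rfloor> (gauss_map x) = x" "1 \<le> \<lfloor>1 / x\<rfloor>"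
  using assms by (auto simp: cf_step_def gauss_map_def frac_def irr_def field_simps)

lemma gauss_cf_step: assumes "z \<in> irr" 
  shows "gauss_map (cf_step d z) = z" "\<lfloor>1 / cf_step d z\<rfloor> = d"
proof -
  have z: "0 \<le> z" "z < 1" using assms by (auto simp: irr_def)
  then have "\<lfloor>z\<rfloor> = 0" by (simp add: floor_eq_iff)
  then show "gauss_map (cf_step d z) = z" "\<lfloor>1 / cf_step d z\<rfloor> = d"
    using z by (auto simp: gauss_map_def cf_step_def frac_def)
qed

lemma dig_ge1: "x \<in> irr \<Longrightarrow> 1 \<le> dig x i"
  by (induction i arbitrary: x) (simp_all only: dig_0 dig_Suc cf_step_gauss gauss_map_irr)

lemma word_dig: "x \<in> irr \<Longrightarrow> word (cf_prefix (dig x) n)"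
  by (auto simp: word_def cf_prefix_def dig_ge1)

lemma cf_val_irr: "z \<in> irr \<Longrightarrow> word w \<Longrightarrow> cf_val w z \<in> irr"
  by (induction w) (auto simp: cf_step_irr)

lemma gauss_map_iterate_irr: "x \<in> irr \<Longrightarrow> (gauss_map ^^ n) x \<in> irr"
  by (induction n) (auto simp: gauss_map_irr)

lemma cf_val_gauss: "x \<in> irr \<Longrightarrow> cf_val (cf_prefix (dig x) n) ((gauss_map ^^ n) x) = x"
proof (induction n arbitrary: x)
  case 0
  show ?case by (simp add: cf_prefix_def)
next
  case (Suc n)
  then show ?case using Suc.IH[of "gauss_map x"]
    by (simp add: cf_prefix_Suc' dig_0 dig_Suc gauss_map_irr cf_step_gauss funpow_swap1 del: funpow.simps(2) add: funpow_Suc_right)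
qed

lemma dig_cf_val:
  "z \<in> irr \<Longrightarrow> word w \<Longrightarrow> cf_prefix (dig (cf_val w z)) (length w + n) = w @ cf_prefix (dig z) n"
proof (induction w)
  case (Cons d w)
  then have "cf_val w z \<in> irr" by (simp add: cf_val_irr)
  then show ?case using Cons
    by (simp add: cf_prefix_Suc' dig_0 dig_Suc gauss_cf_step)
qed simp

lemma gauss_cf_val: "z \<in> irr \<Longrightarrow> word w \<Longrightarrow> (gauss_map ^^ length w) (cf_val w z) = z"
proof (induction w)
  case (Cons d w)
  then have "cf_val w z \<in> irr" by (simp add: cf_val_irr)
  then show ?case using Cons
    by (simp add: gauss_cf_step funpow_Suc_right del: funpow.simps(2))
qed simp

definition cyl :: "int list \<Rightarrow> real set" where
  "cyl w = {x \<in> irr. cf_prefix (dig x) (length w) = w}"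

lemma cyl_eq: assumes "word w" shows "cyl w = cf_val w ` irr"
proof (intro set_eqI iffI)
  fix x assume "x \<in> cyl w"
  then have "x \<in> irr" "cf_prefix (dig x) (length w) = w" by (auto simp: cyl_def)
  then show "x \<in> cf_val w ` irr"
    using cf_val_gauss[of x "length w"] gauss_map_iterate_irr[of x "length w"] by (metis imageI)
next
  fix x assume "x \<in> cf_val w ` irr"
  then show "x \<in> cyl w"
    using assms dig_cf_val[of _ w 0] by (auto simp: cyl_def cf_val_irr) (auto simp: cf_prefix_def)
qed

lemma cf_val_image: 
  assumes "word w" "S \<subseteq> irr"
  shows "cf_val w ` S = {x \<in> cyl w. (gauss_map ^^ length w) x \<in> S}"
proof -
  have "cf_val w ` S \<subseteq> cyl w" using assms cyl_eq by blast
  then show ?thesis using assms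
    by (auto simp: cyl_eq) (auto simp: gauss_cf_val subset_iff)
qed

text \<open>The difference is the determinant, of modulus 1, times z' - z over (q + q' z)(q + q'
  z'), and q grows exponentially.\<close>

lemma cf_val_contraction:
  fixes z z' :: real
  assumes w: "word w" and z: "0 \<le> z" "z \<le> 1" "0 \<le> z'" "z' \<le> 1"
  shows "\<bar>cf_val w z - cf_val w z'\<bar> \<le> 1 / (2 ^ (length w div 2))\<^sup>2"
proof -
  obtain p p' q q' :: int where a: "1 \<le> q" "0 \<le> q'" "q' \<le> q"
    and det: "p * q' - p' * q = - ((-1) ^ length w)"
    and v: "\<And>z::real. 0 \<le> z \<Longrightarrow> cf_val w z = (of_int p + of_int p' * z) / (of_int q + of_int q' * z)"
    and dn: "cf_den 0 w = of_int q"
    using cf_matrix[OF w] by auto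
  have q: "2 ^ (length w div 2) \<le> real_of_int q" using cf_den_growth[OF w, of 0] dn by simp
  have *: "real_of_int q \<le> real_of_int q + real_of_int q' * z" "real_of_int q \<le> real_of_int q + real_of_int q' * z'"
    using a z by auto
  have q1: "real_of_int q \<ge> 1" using a by simp
  have detr: "\<bar>real_of_int p * real_of_int q' - of_int p' * of_int q\<bar> = 1"
    using arg_cong[OF det, of "\<lambda>x. \<bar>real_of_int x\<bar>"] by simp
  have "cf_val w z - cf_val w z' = (of_int p * of_int q' - of_int p' * of_int q) * (z' - z)
      / ((of_int q + of_int q' * z) * (of_int q + of_int q' * z'))"
    unfolding v[OF z(1)] v[OF z(3)] using * q1
    by (subst diff_frac_eq) (auto simp: algebra_simps)
  then have "\<bar>cf_val w z - cf_val w z'\<bar> = \<bar>z' - z\<bar> / ((of_int q + of_int q' * z) * (of_int q + of_int q' * z'))"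
    using * q1 detr by (simp add: abs_mult)
  also have "\<dots> \<le> 1 / (of_int q * of_int q)"
    using * q1 z by (intro frac_le mult_mono) auto
  also have "\<dots> \<le> 1 / (2 ^ (length w div 2))\<^sup>2"
    using q q1 by (intro divide_left_mono) (auto simp: power2_eq_square intro!: mult_mono)
  finally show ?thesis .
qed

section \<open>Distribution of the digits\<close>

lemma irr_eq: "irr = {0<..<1} - \<rat>"
  by (auto simp: irr_def)

lemma irr_borel [measurable]: "irr \<in> sets borel"
proof -
  have "\<rat> \<in> sets (borel :: real measure)" by (rule sets.countable[OF _ countable_rat]) simp
  then show ?thesis unfolding irr_eq by (intro sets.Diff) auto
qed

lemma gauss_map_borel [measurable]: "gauss_map \<in> borel_measurable borel"
  unfolding gauss_map_def frac_def by measurable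

lemma gauss_map_iterate_borel [measurable]: "(gauss_map ^^ n) \<in> borel_measurable borel"
  by (induction n) (auto intro: measurable_comp[OF _ gauss_map_borel])

lemma dig_borel [measurable]: "(\<lambda>x. dig x i) \<in> borel \<rightarrow>\<^sub>M count_space UNIV"
  unfolding dig_def cf_digit_def by measurable

lemma cf_prefix_dig_borel: "(\<lambda>x. cf_prefix (dig x) n) \<in> borel \<rightarrow>\<^sub>M count_space UNIV"
proof (induction n)
  case (Suc n)
  note [measurable] = Suc
  show ?case unfolding cf_prefix_Suc by measurable
qed (simp add: cf_prefix_def)

lemma cyl_borel [measurable]: "cyl w \<in> sets borel"
proof -
  note [measurable] = cf_prefix_dig_borel
  have "cyl w = irr \<inter> {x \<in> space borel. cf_prefix (dig x) (length w) = w}" by (auto simp: cyl_def)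
  also have "\<dots> \<in> sets borel" by (intro sets.Int) measurable
  finally show ?thesis .
qed

lemma cyl_subset: "cyl w \<subseteq> irr"
  by (auto simp: cyl_def)

lemma irr_lmeasurable: "A \<in> sets borel \<Longrightarrow> A \<subseteq> irr \<Longrightarrow> A \<in> lmeasurable"
proof (rule bounded_set_imp_lmeasurable)
  assume "A \<subseteq> irr"
  then have "A \<subseteq> {0..1}" by (auto simp: irr_def)
  then show "bounded A" by (rule bounded_subset[OF bounded_closed_interval])
qed simp

lemma measure_irr: "measure lebesgue irr = 1"
proof -
  have "negligible (\<rat> :: real set)"
    using countable_imp_null_set_lborel[OF countable_rat]
    unfolding negligible_iff_null_sets by (rule null_sets_completionI)
  then have "negligible ({0<..<1} - ({0<..<1} - \<rat>) \<union> (({0<..<1} - \<rat>) - {0<..<1::real}))"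
    by (rule negligible_subset) auto
  then have "measure lebesgue ({0<..<1::real} - \<rat>) = measure lebesgue {0<..<1::real}"
    by (rule measure_negligible_symdiff[rotated]) simp
  then show ?thesis by (simp add: irr_eq)
qed

section \<open>Bounded distortion of the inverse branches\<close>

lemma cf_val_image_borel:
  assumes "word w" "S \<in> sets borel" "S \<subseteq> irr"
  shows "cf_val w ` S \<in> sets borel"
proof -
  have "cf_val w ` S = cyl w \<inter> (gauss_map ^^ length w) -` S \<inter> space borel"
    using cf_val_image[OF assms(1,3)] by auto
  also have "\<dots> \<in> sets borel"
    using cyl_borel[of w] measurable_sets[OF gauss_map_iterate_borel assms(2)] by (simp add: sets.Int)
  finally show ?thesis .
qed

lemma cf_val_image_subset: "word w \<Longrightarrow> S \<subseteq> irr \<Longrightarrow> cf_val w ` S \<subseteq> irr"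
  by (auto intro: cf_val_irr)

lemma cf_val_inj: "word w \<Longrightarrow> inj_on (cf_val w) irr"
  by (rule inj_on_inverseI[of _ "gauss_map ^^ length w"]) (rule gauss_cf_val)

text \<open>Change of variables: the branch is a Moebius map with determinant of modulus 1, so its
  derivative has modulus 1/(q + q' z)^2, which q' \<le> q keeps between 1/(4 q^2) and 1/q^2.\<close>

lemma cf_val_image_measure:
  assumes w: "word w" and S: "S \<in> sets borel" "S \<subseteq> irr"
  defines "q \<equiv> cf_den 0 w"
  shows "measure lebesgue S / (4 * q\<^sup>2) \<le> measure lebesgue (cf_val w ` S)"
    and "measure lebesgue (cf_val w ` S) \<le> measure lebesgue S / q\<^sup>2"
proof -
  obtain p p' r r' :: int where a: "1 \<le> r" "0 \<le> r'" "r' \<le> r"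
    and det: "p * r' - p' * r = - ((-1) ^ length w)"
    and v: "\<And>z::real. 0 \<le> z \<Longrightarrow> cf_val w z = (of_int p + of_int p' * z) / (of_int r + of_int r' * z)"
    and dn: "q = of_int r"
    using cf_matrix[OF w] unfolding q_def by auto
  have detr: "\<bar>real_of_int p * real_of_int r' - of_int p' * of_int r\<bar> = 1"
    using arg_cong[OF det, of "\<lambda>x. \<bar>real_of_int x\<bar>"] by simp
  define D where "D z = real_of_int r + of_int r' * z" for z
  define g' where "g' z = (of_int p' * D z - (of_int p + of_int p' * z) * of_int r') / (D z)\<^sup>2" for z
  have q1: "1 \<le> q" using a dn by simp
  have D: "q \<le> D z" "D z \<le> 2 * q" if "z \<in> irr" for z
  proof -
    have "of_int r' * z \<le> of_int r * 1" using that a by (intro mult_mono) (auto simp: irr_def)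
    then show "q \<le> D z" "D z \<le> 2 * q" using that a by (auto simp: D_def dn irr_def)
  qed
  have g'_abs: "\<bar>g' z\<bar> = 1 / (D z)\<^sup>2" for z
  proof -
    have "of_int p' * D z - (of_int p + of_int p' * z) * of_int r' = - (of_int p * of_int r' - of_int p' * of_int r)"
      by (simp add: D_def algebra_simps)
    then have "\<bar>of_int p' * D z - (of_int p + of_int p' * z) * of_int r'\<bar> = 1"
      using detr by (simp only: abs_minus)
    then show ?thesis unfolding g'_def abs_divide by simp
  qed
  have der: "(cf_val w has_field_derivative g' z) (at z within S)" if "z \<in> S" for z
  proof -
    have zi: "z \<in> irr" using that S by auto
    then have "D z \<noteq> 0" using D[of z] q1 by auto
    then have "((\<lambda>z. (of_int p + of_int p' * z) / D z) has_field_derivative g' z) (at z within S)"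
      unfolding D_def g'_def by (auto intro!: derivative_eq_intros simp: power2_eq_square algebra_simps)
    then show ?thesis
    proof (rule has_field_derivative_transform_within[OF _ zero_less_one that])
      fix x assume "x \<in> S" 
      then have "0 \<le> x" using S by (auto simp: irr_def)
      then show "(of_int p + of_int p' * x) / D x = cf_val w x" by (simp add: v D_def)
    qed
  qed
  have inj: "inj_on (cf_val w) S" using cf_val_inj[OF w] S(2) by (rule inj_on_subset)
  have Sm: "S \<in> lmeasurable" using S by (rule irr_lmeasurable)
  have im: "cf_val w ` S \<in> lmeasurable"
    by (intro irr_lmeasurable cf_val_image_borel cf_val_image_subset w S)
  \<comment> \<open>The constant function 1 on the image turns the change of variables into a
    formula for the measure of the image.\<close>
  have "(\<lambda>x. 1::real) absolutely_integrable_on cf_val w ` S \<and>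
      integral (cf_val w ` S) (\<lambda>x. 1::real) = measure lebesgue (cf_val w ` S)"
    using im by (simp add: lmeasure_integral absolutely_integrable_on_iff_nonneg lmeasurable_iff_integrable_on)
  then have "(\<lambda>x. \<bar>g' x\<bar> * 1) absolutely_integrable_on S \<and> integral S (\<lambda>x. \<bar>g' x\<bar> * 1) = measure lebesgue (cf_val w ` S)"
    by (subst has_absolute_integral_change_of_variables_1'[OF _ der inj]) (use Sm in auto)
  then have int: "(\<lambda>x. 1 / (D x)\<^sup>2) integrable_on S" "integral S (\<lambda>x. 1 / (D x)\<^sup>2) = measure lebesgue (cf_val w ` S)"
    by (auto simp: g'_abs set_lebesgue_integral_eq_integral)
  have const: "integral S (\<lambda>x. c) = measure lebesgue S * c" "(\<lambda>x. c) integrable_on S" for c :: real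
    using Sm lmeasure_integral[OF Sm] integral_mult_left[of S "\<lambda>x. 1::real" c]
    by (auto simp: integrable_on_const)
  have "measure lebesgue S * (1 / (4 * q\<^sup>2)) \<le> measure lebesgue (cf_val w ` S)"
    unfolding const(1)[symmetric] int(2)[symmetric]
  proof (rule integral_le[OF const(2) int(1)])
    fix x assume "x \<in> S"
    then have "x \<in> irr" using S by auto
    then have "(D x)\<^sup>2 \<le> (2 * q)\<^sup>2" using D[of x] q1 by (intro power_mono) auto
    then show "1 / (4 * q\<^sup>2) \<le> 1 / (D x)\<^sup>2"
      using D[OF \<open>x \<in> irr\<close>] q1 by (intro divide_left_mono) (auto simp: power_mult_distrib)
  qed
  then show "measure lebesgue S / (4 * q\<^sup>2) \<le> measure lebesgue (cf_val w ` S)" by simp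
  have "measure lebesgue (cf_val w ` S) \<le> measure lebesgue S * (1 / q\<^sup>2)"
    unfolding const(1)[symmetric] int(2)[symmetric]
  proof (rule integral_le[OF int(1) const(2)])
    fix x assume "x \<in> S"
    then have "x \<in> irr" using S by auto
    then have "q\<^sup>2 \<le> (D x)\<^sup>2" using D[of x] q1 by (intro power_mono) auto
    then show "1 / (D x)\<^sup>2 \<le> 1 / q\<^sup>2"
      using D[OF \<open>x \<in> irr\<close>] q1 by (intro divide_left_mono) auto
  qed
  then show "measure lebesgue (cf_val w ` S) \<le> measure lebesgue S / q\<^sup>2" by simp
qed

text \<open>Comparing the estimates for \<open>S\<close> with those for \<open>irr\<close>, whose
  measure is 1, eliminates the denominator at the cost of a factor 4.\<close>

lemma cf_val_image_distortion:
  assumes w: "word w" and S: "S \<in> sets borel" "S \<subseteq> irr"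
  shows "measure lebesgue S * measure lebesgue (cyl w) \<le> 4 * measure lebesgue (cf_val w ` S)"
    and "measure lebesgue (cf_val w ` S) \<le> 4 * measure lebesgue S * measure lebesgue (cyl w)"
proof -
  define q where "q = cf_den 0 w"
  have q: "1 \<le> q" using cf_den_ge1[OF w, of 0] by (simp add: q_def)
  note I = cf_val_image_measure[OF w irr_borel subset_refl, folded q_def cyl_eq[OF w], unfolded measure_irr]
  note J = cf_val_image_measure[OF w S, folded q_def]
  have "measure lebesgue S * measure lebesgue (cyl w) \<le> measure lebesgue S * (1 / q\<^sup>2)"
    using I by (intro mult_left_mono) auto
  also have "\<dots> \<le> 4 * measure lebesgue (cf_val w ` S)" using J(1) q by (simp add: field_simps)
  finally show "measure lebesgue S * measure lebesgue (cyl w) \<le> 4 * measure lebesgue (cf_val w ` S)" .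
  have "measure lebesgue (cf_val w ` S) \<le> 4 * measure lebesgue S * (1 / (4 * q\<^sup>2))" using J(2) q by simp
  also have "\<dots> \<le> 4 * measure lebesgue S * measure lebesgue (cyl w)"
    using I by (intro mult_left_mono) auto
  finally show "measure lebesgue (cf_val w ` S) \<le> 4 * measure lebesgue S * measure lebesgue (cyl w)" .
qed

text \<open>The cylinders of one length form a countable partition of \<open>irr\<close>, so the
  local inequalities add up. The sums are extended-valued, which avoids summability
  questions.\<close>

lemma measure_le_of_cylinders:
  assumes A: "A \<in> sets borel" "A \<subseteq> irr" and C: "C \<in> sets borel" "C \<subseteq> irr" and c: "0 \<le> c"
    and le: "\<And>w. word w \<Longrightarrow> length w = n \<Longrightarrow> measure lebesgue (A \<inter> cyl w) \<le> c * measure lebesgue (C \<inter> cyl w)"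
  shows "measure lebesgue A \<le> c * measure lebesgue C"
proof -
  define W where "W = {w. word w \<and> length w = n}"
  have eq: "emeasure lebesgue S = (\<integral>\<^sup>+w. emeasure lebesgue (S \<inter> cyl w) \<partial>count_space W)"
    if "S \<in> sets borel" "S \<subseteq> irr" for S
  proof -
    have "S = (\<Union>w\<in>W. S \<inter> cyl w)"
      using that(2) word_dig unfolding cyl_def W_def by fastforce
    then have "emeasure lebesgue S = emeasure lebesgue (\<Union>w\<in>W. S \<inter> cyl w)" by simp
    also have "\<dots> = (\<integral>\<^sup>+w. emeasure lebesgue (S \<inter> cyl w) \<partial>count_space W)"
    proof (rule emeasure_UN_countable)
      show "disjoint_family_on (\<lambda>w. S \<inter> cyl w) W"
        by (auto simp: disjoint_family_on_def cyl_def W_def)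
    qed (use that(1) in auto)
    finally show ?thesis .
  qed
  have fin: "emeasure lebesgue S = ennreal (measure lebesgue S)" if "S \<in> sets borel" "S \<subseteq> irr" for S
    using irr_lmeasurable[OF that] by (simp add: emeasure_eq_measure2 fmeasurableD2 emeasure_eq_ennreal_measure)
  have "emeasure lebesgue A \<le> (\<integral>\<^sup>+w. ennreal c * emeasure lebesgue (C \<inter> cyl w) \<partial>count_space W)"
    unfolding eq[OF A]
  proof (intro nn_integral_mono)
    fix w assume "w \<in> space (count_space W)"
    then have "measure lebesgue (A \<inter> cyl w) \<le> c * measure lebesgue (C \<inter> cyl w)"
      using le by (auto simp: W_def)
    moreover
    have "A \<inter> cyl w \<subseteq> irr" "C \<inter> cyl w \<subseteq> irr" using cyl_subset by auto
    then have "emeasure lebesgue (A \<inter> cyl w) = ennreal (measure lebesgue (A \<inter> cyl w))"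
      "emeasure lebesgue (C \<inter> cyl w) = ennreal (measure lebesgue (C \<inter> cyl w))"
      using A C by (intro fin sets.Int cyl_borel; simp)+
    ultimately show "emeasure lebesgue (A \<inter> cyl w) \<le> ennreal c * emeasure lebesgue (C \<inter> cyl w)"
      using c by (simp only: ennreal_mult'[symmetric] ennreal_leI)
  qed
  also have "\<dots> = ennreal c * emeasure lebesgue C"
    by (simp add: nn_integral_cmult eq[OF C])
  finally show ?thesis using fin[OF A] fin[OF C] c
    by (simp add: ennreal_mult[symmetric] ennreal_le_iff)
qed

section \<open>Rarity of large digits\<close>

text \<open>Within a cylinder of length n the event is the branch image of the same event for the
  first digit, which lies in [0, 1/X]; distortion costs the factor 4.\<close>

lemma measure_dig_gt:
  fixes X :: real
  assumes "0 < X"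
  shows "measure lebesgue {x \<in> irr. X < of_int (dig x n)} \<le> 4 / X"
proof -
  define S where "S = {z \<in> irr. X < of_int (dig z 0)}"
  have S: "S \<in> sets borel" "S \<subseteq> irr"
  proof -
    have "S = irr \<inter> {z \<in> space borel. X < of_int (dig z 0)}" by (auto simp: S_def)
    also have "\<dots> \<in> sets borel" by (intro sets.Int irr_borel) measurable
    finally show "S \<in> sets borel" .
  qed (auto simp: S_def)
  have "S \<subseteq> {0..1 / X}"
  proof
    fix z assume "z \<in> S"
    then have "0 < z" "X < of_int \<lfloor>1 / z\<rfloor>" by (auto simp: S_def irr_def dig_0)
    moreover have "of_int \<lfloor>1 / z\<rfloor> \<le> 1 / z" by simp
    ultimately have "X < 1 / z" by linarith
    then show "z \<in> {0..1 / X}" using \<open>0 < z\<close> assms by (auto simp: field_simps)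
  qed
  then have "measure lebesgue S \<le> measure lebesgue {0..1 / X}"
    using irr_lmeasurable[OF S] by (intro measure_mono_fmeasurable) auto
  then have mS: "measure lebesgue S \<le> 1 / X" using assms by simp
  define A where "A = {x \<in> irr. X < of_int (dig x n)}"
  have A: "A \<in> sets borel" "A \<subseteq> irr"
  proof -
    have "A = irr \<inter> {z \<in> space borel. X < of_int (dig z n)}" by (auto simp: A_def)
    also have "\<dots> \<in> sets borel" by (intro sets.Int irr_borel) measurable
    finally show "A \<in> sets borel" .
  qed (auto simp: A_def)
  have "measure lebesgue A \<le> (4 / X) * measure lebesgue irr"
  proof (rule measure_le_of_cylinders[OF A irr_borel subset_refl])
    fix w assume w: "word w" "length w = n"
    have "dig x n = dig ((gauss_map ^^ n) x) 0" for x
      by (induction n arbitrary: x) (auto simp: dig_Suc funpow_Suc_right simp del: funpow.simps(2))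
    then have "A \<inter> cyl w = cf_val w ` S"
      unfolding cf_val_image[OF w(1) S(2)]
      using w(2) cyl_subset[of w] gauss_map_iterate_irr[of _ n] by (auto simp: A_def S_def)
    then have "measure lebesgue (A \<inter> cyl w) \<le> 4 * measure lebesgue S * measure lebesgue (cyl w)"
      using cf_val_image_distortion[OF w(1) S] by simp
    also have "\<dots> \<le> 4 * (1 / X) * measure lebesgue (cyl w)"
      using mS by (intro mult_right_mono mult_left_mono) auto
    finally show "measure lebesgue (A \<inter> cyl w) \<le> (4 / X) * measure lebesgue (irr \<inter> cyl w)"
      using cyl_subset[of w] by (simp add: Int_absorb1)
  qed (use assms in auto)
  then show ?thesis by (simp add: A_def measure_irr)
qed

text \<open>Growing K exhausts almost all of \<open>irr\<close>, while a single K gives uniform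
  estimates. \<open>Suc n\<close> is the index of \<open>dig x n\<close> when digits are counted
  from 1.\<close>

definition slow :: "real \<Rightarrow> real \<Rightarrow> real set" where
  "slow s K = {x \<in> irr. \<forall>n. of_int (dig x n) \<le> K * real (Suc n) powr s}"

lemma slow_borel: "slow s K \<in> sets borel"
proof -
  have "slow s K = irr \<inter> {x \<in> space borel. \<forall>n. of_int (dig x n) \<le> K * real (Suc n) powr s}"
    by (auto simp: slow_def)
  also have "\<dots> \<in> sets borel" by (intro sets.Int irr_borel) measurable
  finally show ?thesis .
qed

lemma slow_subset: "slow s K \<subseteq> irr"
  by (auto simp: slow_def)

text \<open>Union bound over positions: the failures 4/(K (n + 1)^s) are summable as s > 1, and
  their sum scales like 1/K.\<close>

lemma measure_not_slow:
  assumes s: "1 < s"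
  shows "\<exists>C. \<forall>K>0. measure lebesgue (irr - slow s K) \<le> C / K"
proof (intro exI allI impI)
  fix K :: real assume K: "0 < K"
  define a where "a n = 4 / (K * real (Suc n) powr s)" for n
  define A where "A n = {x \<in> irr. K * real (Suc n) powr s < of_int (dig x n)}" for n
  have sm: "summable (\<lambda>n. real (Suc n) powr - s)"
    using s summable_real_powr_iff[of "-s"] by (subst summable_Suc_iff) auto
  have a_eq: "a n = (4 / K) * real (Suc n) powr - s" for n
    by (simp add: a_def powr_minus field_simps)
  have A: "A n \<in> sets borel" "A n \<subseteq> irr" for n
  proof -
    have "A n = irr \<inter> {z \<in> space borel. K * real (Suc n) powr s < of_int (dig z n)}" by (auto simp: A_def)
    also have "\<dots> \<in> sets borel" by (intro sets.Int irr_borel) measurable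
    finally show "A n \<in> sets borel" .
  qed (auto simp: A_def)
  have mA: "measure lebesgue (A n) \<le> a n" for n
    unfolding A_def a_def by (rule measure_dig_gt) (use K in auto)
  have sumA: "summable a" unfolding a_eq by (intro summable_mult sm)
  have sumA': "summable (\<lambda>n. measure lebesgue (A n))"
    by (rule summable_comparison_test'[OF sumA, of 0]) (use mA in auto)
  have "irr - slow s K = (\<Union>n. A n)" by (auto simp: slow_def A_def not_le simp flip: not_less)
  then have "measure lebesgue (irr - slow s K) \<le> (\<Sum>n. measure lebesgue (A n))"
  proof (simp only:, intro measure_subadditive_countably)
    have "emeasure lebesgue (A n) = ennreal (measure lebesgue (A n))" for n
      using irr_lmeasurable[OF A] by (rule emeasure_eq_measure2)
    then have "(\<Sum>n. emeasure lebesgue (A n)) = ennreal (\<Sum>n. measure lebesgue (A n))"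
      using suminf_ennreal2[OF measure_nonneg sumA'] by (simp only:)
    then show "(\<Sum>n. emeasure lebesgue (A n)) \<noteq> \<infinity>" by (simp only: ennreal_neq_top infinity_ennreal_def not_False_eq_True)
    show "range A \<subseteq> sets lebesgue" using A by auto
  qed
  also have "\<dots> \<le> suminf a" by (intro suminf_le mA sumA sumA')
  also have "\<dots> = (4 * (\<Sum>n. real (Suc n) powr - s)) / K"
    unfolding a_eq by (subst suminf_mult[OF sm]) simp
  finally show "measure lebesgue (irr - slow s K) \<le> (4 * (\<Sum>n. real (Suc n) powr - s)) / K" .
qed

section \<open>Density along cylinders\<close>

text \<open>The cylinders contained in an open \<open>U\<close> around \<open>E\<close> eventually
  capture all of \<open>E\<close>, so the local bound gives |E| \<le> (1 - c)|U|; outer regularity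
  then shrinks \<open>U\<close> to \<open>E\<close>.\<close>

lemma measure_zero_of_cylinder_density:
  assumes E: "E \<in> sets borel" "E \<subseteq> irr" and c: "0 < c" "c \<le> 1"
    and le: "\<And>w. word w \<Longrightarrow> measure lebesgue (E \<inter> cyl w) \<le> (1 - c) * measure lebesgue (cyl w)"
  shows "measure lebesgue E = 0"
proof -
  have op: "measure lebesgue E \<le> (1 - c) * measure lebesgue U" if U: "open U" "E \<subseteq> U" "U \<in> lmeasurable" for U
  proof -
    define V where "V n = {x \<in> irr. cyl (cf_prefix (dig x) n) \<subseteq> U}" for n
    have Vcyl: "V n \<inter> cyl w = (if cyl w \<subseteq> U then cyl w else {})" if "length w = n" for n w
      using that by (auto simp: V_def cyl_def)
    have V: "V n \<in> sets borel" "V n \<subseteq> irr" for n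
    proof -
      have "V n = irr \<inter> ((\<lambda>x. cf_prefix (dig x) n) -` {w. cyl w \<subseteq> U} \<inter> space borel)" by (auto simp: V_def)
      also have "\<dots> \<in> sets borel" by (intro sets.Int irr_borel measurable_sets[OF cf_prefix_dig_borel]) auto
      finally show "V n \<in> sets borel" .
    qed (auto simp: V_def)
    have VU: "V n \<subseteq> U" for n
      by (auto simp: V_def cyl_def)
    have "V n \<subseteq> V (Suc n)" for n
      by (auto simp: V_def cyl_def cf_prefix_Suc subset_iff)
    then have inc: "incseq V" by (rule incseq_SucI)
    have cover: "E \<subseteq> (\<Union>n. V n)"
    proof
      fix x assume x: "x \<in> E"
      then obtain e where e: "0 < e" "ball x e \<subseteq> U" using U openE by blast
      have xi: "x \<in> irr" using x E by auto
      \<comment> \<open>Points sharing 2m digits are at most 4^(-m) apart, hence closer than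
        e.\<close>
      obtain m where m: "(1/2) ^ m < e" using real_arch_pow_inv[OF e(1), of "1/2"] by auto
      have "cyl (cf_prefix (dig x) (2 * m)) \<subseteq> ball x e"
      proof
        fix y assume y: "y \<in> cyl (cf_prefix (dig x) (2 * m))"
        let ?w = "cf_prefix (dig x) (2 * m)" and ?T = "gauss_map ^^ (2 * m)"
        have yi: "y \<in> irr" and "cf_prefix (dig y) (2 * m) = ?w" using y by (auto simp: cyl_def)
        then have "cf_val ?w (?T x) = x" "cf_val ?w (?T y) = y"
          using cf_val_gauss[OF xi, of "2*m"] cf_val_gauss[OF yi, of "2*m"] by auto
        moreover have "\<bar>cf_val ?w (?T x) - cf_val ?w (?T y)\<bar> \<le> 1 / (2 ^ (length ?w div 2))\<^sup>2"
          using gauss_map_iterate_irr[OF xi, of "2*m"] gauss_map_iterate_irr[OF yi, of "2*m"]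
          by (intro cf_val_contraction word_dig xi) (auto simp: irr_def)
        ultimately have "\<bar>x - y\<bar> \<le> (1 / 2 ^ m)\<^sup>2" by (simp add: power_divide)
        also have "\<dots> \<le> 1 / 2 ^ m" by (simp add: power2_eq_square field_simps)
        also have "\<dots> < e" using m by (simp add: power_divide)
        finally show "y \<in> ball x e" by (simp add: dist_real_def)
      qed
      then show "x \<in> (\<Union>n. V n)" using e xi by (auto simp: V_def)
    qed
    have bound: "measure lebesgue (E \<inter> V n) \<le> (1 - c) * measure lebesgue U" for n
    proof -
      have "measure lebesgue (E \<inter> V n) \<le> (1 - c) * measure lebesgue (V n)"
      proof (rule measure_le_of_cylinders[of _ _ _ n])
        fix w assume w: "word w" "length w = n"
        show "measure lebesgue (E \<inter> V n \<inter> cyl w) \<le> (1 - c) * measure lebesgue (V n \<inter> cyl w)"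
          unfolding Int_assoc Vcyl[OF w(2)] using le[OF w(1)] by auto
      qed (use E V c in auto)
      also have "\<dots> \<le> (1 - c) * measure lebesgue U"
        using c by (intro mult_left_mono measure_mono_fmeasurable VU U(3)) (use V in auto)
      finally show ?thesis .
    qed
    have Vm: "E \<inter> V n \<in> lmeasurable" for n
      by (intro irr_lmeasurable) (use E V in auto)
    have "E = (\<Union>n. E \<inter> V n)" using cover by auto
    moreover have "(\<lambda>n. measure lebesgue (E \<inter> V n)) \<longlonglongrightarrow> measure lebesgue (\<Union>n. E \<inter> V n)"
    proof (rule Lim_measure_incseq)
      show "incseq (\<lambda>n. E \<inter> V n)" using inc by (auto simp: incseq_def)
      have "E \<in> lmeasurable" using E by (rule irr_lmeasurable)
      then show "emeasure lebesgue (\<Union>n. E \<inter> V n) \<noteq> \<infinity>"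
        using \<open>E = (\<Union>n. E \<inter> V n)\<close> fmeasurableD2 by fastforce
    qed (use Vm in auto)
    ultimately show ?thesis using bound by (metis LIMSEQ_le_const2)
  qed
  have Em: "E \<in> lmeasurable" using E by (rule irr_lmeasurable)
  have "measure lebesgue E \<le> (1 - c) * measure lebesgue E"
  proof (rule field_le_epsilon)
    fix e :: real assume e: "0 < e"
    obtain U where U: "open U" "E \<subseteq> U" "U \<in> lmeasurable" "measure lebesgue U < measure lebesgue E + e"
    proof -
      from Em e obtain U where U: "open U" "E \<subseteq> U" "U - E \<in> lmeasurable" "emeasure lebesgue (U - E) < ennreal e"
        using sets_lebesgue_outer_open[of E e] by (metis fmeasurableD)
      have "U = E \<union> (U - E)" using U by auto
      then have "U \<in> lmeasurable" using fmeasurable.Un[OF Em U(3)] by simp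
      moreover have "measure lebesgue U = measure lebesgue E + measure lebesgue (U - E)"
        using measurable_measure_Diff[OF \<open>U \<in> lmeasurable\<close> fmeasurableD[OF Em] U(2)] by simp
      moreover have "measure lebesgue (U - E) < e"
        using U(3,4) e by (metis emeasure_eq_measure2 ennreal_less_iff measure_nonneg)
      ultimately show ?thesis using that U by auto
    qed
    have "measure lebesgue E \<le> (1 - c) * measure lebesgue U" by (rule op) (use U in auto)
    also have "\<dots> \<le> (1 - c) * (measure lebesgue E + e)" using c U by (intro mult_left_mono) auto
    also have "\<dots> \<le> (1 - c) * measure lebesgue E + e" using c e by (simp add: algebra_simps)
    finally show "measure lebesgue E \<le> (1 - c) * measure lebesgue E + e" .
  qed
  then have "c * measure lebesgue E \<le> 0" by (simp add: algebra_simps)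
  then show ?thesis using c measure_nonneg[of lebesgue E] by (smt (verit) mult_pos_pos)
qed

text \<open>If no \<open>u\<close> worked, every cylinder of a word \<open>u\<close> would contain,
  for some \<open>w\<close> in \<open>W\<close>, the image of \<open>B\<close> under
  \<open>u @ w\<close>, disjoint from \<open>E\<close>. By distortion this image has proportion at
  least a quarter of |S w|, and finiteness of \<open>W\<close> makes the lower bound
  uniform.\<close>

lemma positive_set_meets_extensions:
  assumes E: "E \<in> sets borel" "E \<subseteq> irr" "measure lebesgue E > 0"
    and B: "B \<in> sets borel" "B \<subseteq> irr" "measure lebesgue B > 0"
    and W: "finite W" "\<And>w. w \<in> W \<Longrightarrow> word w"
  shows "\<exists>u. word u \<and> (\<forall>w\<in>W. \<exists>z\<in>B. cf_val (u @ w) z \<in> E)"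
proof (rule ccontr)
  assume no: "\<not> ?thesis"
  define S where "S w = cf_val w ` B" for w
  have S: "S w \<in> sets borel" "S w \<subseteq> irr" if "w \<in> W" for w
    using that W B cf_val_image_borel[of w B] cf_val_image_subset[of w B] by (auto simp: S_def)
  have S_pos: "measure lebesgue (S w) > 0" if "w \<in> W" for w
  proof -
    have "1 \<le> cf_den 0 w" using cf_den_ge1[of w 0] W that by auto
    then have "0 < measure lebesgue B / (4 * (cf_den 0 w)\<^sup>2)" using B by simp
    also have "\<dots> \<le> measure lebesgue (S w)"
      unfolding S_def by (rule cf_val_image_measure) (use W that B in auto)
    finally show ?thesis .
  qed
  \<comment> \<open>The inserted 1 makes the minimum meaningful for empty \<open>W\<close> and
    ensures c \<le> 1.\<close>
  define c where "c = Min (insert 1 ((\<lambda>w. measure lebesgue (S w) / 4) ` W))"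
  have c: "0 < c" "c \<le> 1" using W S_pos by (auto simp: c_def)
  have cS: "c \<le> measure lebesgue (S w) / 4" if "w \<in> W" for w
    unfolding c_def using W that by (intro Min_le) auto
  have "measure lebesgue E = 0"
  proof (rule measure_zero_of_cylinder_density[OF E(1,2) c])
    fix u assume u: "word u"
    then obtain w where w: "w \<in> W" "\<And>z. z \<in> B \<Longrightarrow> cf_val (u @ w) z \<notin> E" using no by auto
    have wu: "cf_val u ` S w \<subseteq> cyl u" using S(2)[OF w(1)] cyl_eq[OF u] by blast
    have dj: "E \<inter> (cf_val u ` S w) = {}" using w(2) by (auto simp: S_def)
    have imb: "cf_val u ` S w \<in> sets borel" using S[OF w(1)] u by (intro cf_val_image_borel)
    then have iml: "cf_val u ` S w \<in> lmeasurable" using wu cyl_subset by (intro irr_lmeasurable) auto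
    have cl: "cyl u \<in> lmeasurable" by (intro irr_lmeasurable cyl_borel cyl_subset)
    have "c * measure lebesgue (cyl u) \<le> measure lebesgue (S w) / 4 * measure lebesgue (cyl u)"
      using cS[OF w(1)] by (intro mult_right_mono) auto
    also have "\<dots> \<le> measure lebesgue (cf_val u ` S w)"
      using cf_val_image_distortion(1)[OF u S[OF w(1)]] by simp
    finally have 1: "c * measure lebesgue (cyl u) \<le> measure lebesgue (cf_val u ` S w)" .
    have "measure lebesgue (E \<inter> cyl u) \<le> measure lebesgue (cyl u - cf_val u ` S w)"
      using dj E imb by (intro measure_mono_fmeasurable fmeasurable.Diff cl iml) auto
    also have "\<dots> = measure lebesgue (cyl u) - measure lebesgue (cf_val u ` S w)"
      by (rule measurable_measure_Diff[OF cl]) (use iml wu in auto)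
    finally show "measure lebesgue (E \<inter> cyl u) \<le> (1 - c) * measure lebesgue (cyl u)"
      using 1 by (simp add: algebra_simps)
  qed
  then show False using E by simp
qed

section \<open>The series representing the limit\<close>

text \<open>The sign \<open>e\<close> is that of the argument at which \<open>h\<close> is evaluated next; it alternates, starting from \<open>1\<close>
  at the beginning of the expansion.\<close>

fun expo :: "int \<Rightarrow> int list \<Rightarrow> int" where
  "expo e [] = 0"
| "expo e (d # w) = e * (d - 3) + expo (- e) w"

lemma expo_append: "expo e (v @ w) = expo e v + expo ((-1) ^ length v * e) w"
  by (induction v arbitrary: e) auto

text \<open>Sign 1 and base point 0 give the coefficient \<open>c\<^sub>n\<close> of the series;
  other values give its change when a further word is read.\<close>

definition coef :: "complex \<Rightarrow> complex \<Rightarrow> int \<Rightarrow> real \<Rightarrow> int list \<Rightarrow> complex" where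
  "coef \<theta> k e y w = \<theta> powi expo e w * of_real (cf_den y w) powr (- k)"

text \<open>Horner form: each digit factors out its own coefficient, so what follows a prefix is a
  sum of the same kind with a new sign and base point.\<close>

fun psum :: "complex \<Rightarrow> complex \<Rightarrow> (real \<Rightarrow> complex) \<Rightarrow> int \<Rightarrow> real \<Rightarrow> int list \<Rightarrow> complex" where
  "psum \<theta> k h e y [] = 0"
| "psum \<theta> k h e y (d # w) =
     coef \<theta> k e y [d] * (h (of_int e * cf_step d y) + psum \<theta> k h (- e) (cf_step d y) w)"

lemma cf_rev_nonneg: "word w \<Longrightarrow> 0 \<le> y \<Longrightarrow> 0 \<le> cf_rev w (y::real)"
  by (induction w arbitrary: y) (auto simp: cf_step_pos less_imp_le)

lemma cf_den_pos: "word w \<Longrightarrow> 0 \<le> y \<Longrightarrow> 0 < cf_den y w"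
  using cf_den_ge1[of w y] by simp

lemma powr_of_real_mult:
  fixes a b :: real and k :: complex
  assumes "0 < a" "0 < b"
  shows "of_real (a * b) powr k = of_real a powr k * of_real b powr k"
  using assms by (simp add: powr_def Ln_of_real ln_mult distrib_left exp_add del: of_real_mult)

lemma coef_append:
  assumes "\<theta> \<noteq> 0" "word v" "word w" "0 \<le> y"
  shows "coef \<theta> k e y (v @ w) = coef \<theta> k e y v * coef \<theta> k ((-1) ^ length v * e) (cf_rev v y) w"
proof -
  have "0 < cf_den y v" "0 < cf_den (cf_rev v y) w"
    using assms by (auto intro!: cf_den_pos cf_rev_nonneg)
  from powr_of_real_mult[OF this, of "- k"] show ?thesis
    using assms(1) by (simp add: coef_def expo_append cf_den_append power_int_add)
qed

lemma coef_Nil [simp]: "coef \<theta> k e y [] = 1"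
  by (simp add: coef_def)

lemma psum_append:
  assumes "\<theta> \<noteq> 0" "word v" "word w" "0 \<le> y"
  shows "psum \<theta> k h e y (v @ w) =
    psum \<theta> k h e y v + coef \<theta> k e y v * psum \<theta> k h ((-1) ^ length v * e) (cf_rev v y) w"
  using assms(2,4)
proof (induction v arbitrary: e y)
  case (Cons d v)
  have y': "0 \<le> cf_step d y" using Cons.prems by (simp add: cf_step_pos less_imp_le)
  have "coef \<theta> k e y (d # v) = coef \<theta> k e y [d] * coef \<theta> k (- e) (cf_step d y) v"
    using coef_append[of \<theta> "[d]" v y k e] Cons.prems assms(1) by simp
  then show ?case
    using Cons.IH[OF _ y', of "- e"] Cons.prems by (simp add: algebra_simps)
qed simp

lemma psum_snoc:
  assumes "\<theta> \<noteq> 0" "word (w @ [d])" "0 \<le> y"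
  shows "psum \<theta> k h e y (w @ [d]) = psum \<theta> k h e y w
    + coef \<theta> k e y (w @ [d]) * h (of_int ((-1) ^ length w * e) * cf_rev (w @ [d]) y)"
  using assms by (simp add: psum_append coef_append)

lemma psum_cf_prefix:
  assumes "\<theta> \<noteq> 0" "\<And>i. 1 \<le> b i" "0 \<le> y"
  shows "psum \<theta> k h e y (cf_prefix b n) = (\<Sum>i<n. coef \<theta> k e y (cf_prefix b (Suc i))
     * h (of_int ((-1) ^ i * e) * cf_rev (cf_prefix b (Suc i)) y))"
proof (induction n)
  case (Suc n)
  have "word (cf_prefix b (Suc n))" using assms by (auto simp: word_def cf_prefix_def)
  then have "word (cf_prefix b n @ [b n])" by (simp only: cf_prefix_Suc)
  from psum_snoc[OF assms(1) this assms(3)] Suc show ?case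
    by (simp add: cf_prefix_Suc)
qed (simp add: cf_prefix_def)

lemma norm_coef:
  assumes "norm \<theta> = 1" "word w" "0 \<le> y"
  shows "norm (coef \<theta> k e y w) = cf_den y w powr (- Re k)"
  using cf_den_pos[OF assms(2,3)] assms(1)
  by (simp add: coef_def norm_mult norm_power_int norm_powr_real_powr)

section \<open>Absolute convergence with uniform bounds\<close>

text \<open>As n^\<sigma> = o(n), the terms are eventually below a geometric sequence of ratio
  exp(-\<beta>/2).\<close>

lemma summable_exp_powr_minus_linear:
  fixes A \<beta> \<sigma> :: real
  assumes "0 < \<beta>" "\<sigma> < 1"
  shows "summable (\<lambda>n. exp (A * real n powr \<sigma> - \<beta> * real n))"
proof -
  have "((\<lambda>n. \<bar>A\<bar> * real n powr (\<sigma> - 1)) \<longlongrightarrow> \<bar>A\<bar> * 0) sequentially"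
    using assms by (intro tendsto_mult tendsto_const tendsto_neg_powr filterlim_real_sequentially) auto
  then have "eventually (\<lambda>n. \<bar>A\<bar> * real n powr (\<sigma> - 1) < \<beta> / 2) sequentially"
    using assms by (intro order_tendstoD(2)[of _ 0]) auto
  then have "eventually (\<lambda>n. norm (exp (A * real n powr \<sigma> - \<beta> * real n)) \<le> exp (- \<beta> / 2) ^ n) sequentially"
    using eventually_gt_at_top[of 0]
  proof eventually_elim
    case (elim n)
    have "A * real n powr \<sigma> \<le> \<bar>A\<bar> * real n powr \<sigma>" by (intro mult_right_mono) auto
    also have "\<bar>A\<bar> * real n powr \<sigma> = \<bar>A\<bar> * (real n powr (\<sigma> - 1) * real n)"
      using elim(2) by (simp add: powr_diff)
    also have "\<bar>A\<bar> * (real n powr (\<sigma> - 1) * real n) \<le> \<beta> / 2 * real n"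
      unfolding mult.assoc[symmetric] using elim by (intro mult_right_mono) auto
    finally have "A * real n powr \<sigma> - \<beta> * real n \<le> real n * (- \<beta> / 2)" by (simp add: mult.commute)
    then show ?case by (simp add: exp_of_nat_mult[symmetric])
  qed
  then show ?thesis
    by (rule summable_comparison_test_ev) (use assms in \<open>auto intro: summable_geometric\<close>)
qed

text \<open>Digits of size n^(1 + \<delta>) allow \<open>h\<close> to reach exp(A n^(1 -
  \<delta>^2)), still subexponential, whereas the coefficients decay exponentially at a rate valid
  for every base point and sign; hence a common \<open>M\<close>.\<close>

lemma tails_converge_boundedly:
  fixes \<theta> k :: complex and h :: "real \<Rightarrow> complex"
  assumes k: "0 < Re k" and \<theta>: "norm \<theta> = 1" and \<delta>: "0 < \<delta>" "\<delta> < 1" and K: "0 < K"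
    and bound: "\<And>x. 0 < \<bar>x\<bar> \<Longrightarrow> \<bar>x\<bar> \<le> 1 \<Longrightarrow> norm (h x) \<le> C * exp (\<bar>x\<bar> powr (- 1 + \<delta>))"
  shows "\<exists>M. \<forall>z\<in>slow (1 + \<delta>) K. \<forall>y\<in>{0..1}. \<forall>e\<in>{-1, 1}. \<exists>r. norm r \<le> M \<and>
      (\<lambda>n. psum \<theta> k h e y (cf_prefix (dig z) n)) \<longlonglongrightarrow> r"
proof -
  define \<rho> where "\<rho> = Re k"
  have C: "0 \<le> C"
  proof -
    have "0 \<le> norm (h 1)" by simp
    also have "\<dots> \<le> C * exp 1" using bound[of 1] by simp
    finally show ?thesis by (simp add: zero_le_mult_iff)
  qed
  \<comment> \<open>The rate comes from denominators of size at least 2^(n div 2); the factor exp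
    \<beta> in \<open>a\<close> pays for rounding n/2 down, and the 1 in K + 1 for the base point
    added to the digit.\<close>
  define \<beta> where "\<beta> = \<rho> * ln 2 / 2"
  define A where "A = (K + 1) powr (1 - \<delta>)"
  define \<sigma> where "\<sigma> = (1 + \<delta>) * (1 - \<delta>)"
  define a where "a n = C * exp \<beta> * exp (A * real n powr \<sigma> - \<beta> * real n)" for n
  have \<beta>: "0 < \<beta>" using k by (simp add: \<beta>_def \<rho>_def)
  have \<sigma>: "\<sigma> < 1" using \<delta> by (simp add: \<sigma>_def algebra_simps)
  have "summable a" unfolding a_def
    by (intro summable_mult summable_exp_powr_minus_linear \<beta> \<sigma>)
  then have sa: "summable (\<lambda>i. a (Suc i))" by (subst summable_Suc_iff)
  show ?thesis
  proof (rule exI, intro ballI)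
    fix z y :: real and e :: int
    assume z: "z \<in> slow (1 + \<delta>) K" and y: "y \<in> {0..1}" and e: "e \<in> {-1, 1}"
    let ?b = "dig z"
    have zi: "z \<in> irr" using z slow_subset by blast
    define t where "t i = coef \<theta> k e y (cf_prefix ?b (Suc i))
       * h (of_int ((-1) ^ i * e) * cf_rev (cf_prefix ?b (Suc i)) y)" for i
    have t: "norm (t i) \<le> a (Suc i)" for i
    proof -
      let ?w = "cf_prefix ?b (Suc i)" and ?y = "cf_rev (cf_prefix ?b i) y"
      have ww: "word ?w" "word (cf_prefix ?b i)" using word_dig[OF zi] by auto
      have y': "0 \<le> ?y" "?y \<le> 1" using cf_rev_unit[OF ww(2)] y by auto
      have d: "1 \<le> ?b i" using dig_ge1[OF zi] .
      define s where "s = of_int (?b i) + ?y"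
      have s: "1 \<le> s" using d y' by (simp add: s_def)
      have rev: "cf_rev ?w y = 1 / s" by (simp add: cf_prefix_Suc cf_step_def s_def)
      have n1: "1 \<le> real (Suc i) powr (1 + \<delta>)" using \<delta> by (intro ge_one_powr_ge_zero) auto
      have "of_int (?b i) \<le> K * real (Suc i) powr (1 + \<delta>)" using z by (simp add: slow_def)
      then have "s \<le> K * real (Suc i) powr (1 + \<delta>) + real (Suc i) powr (1 + \<delta>)"
        using n1 y' by (simp add: s_def)
      then have "s \<le> (K + 1) * real (Suc i) powr (1 + \<delta>)" by (simp add: algebra_simps)
      then have "s powr (1 - \<delta>) \<le> ((K + 1) * real (Suc i) powr (1 + \<delta>)) powr (1 - \<delta>)"
        using s \<delta> by (intro powr_mono2) auto
      also have "\<dots> = A * real (Suc i) powr \<sigma>"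
        using K by (simp add: A_def \<sigma>_def powr_mult powr_powr)
      finally have s_pow: "s powr (1 - \<delta>) \<le> A * real (Suc i) powr \<sigma>" .
      have ab: "\<bar>of_int ((-1) ^ i * e) * cf_rev ?w y\<bar> = 1 / s"
        using e s unfolding rev by (auto simp: abs_mult power_abs)
      have "norm (h (of_int ((-1) ^ i * e) * cf_rev ?w y)) \<le> C * exp ((1 / s) powr (- 1 + \<delta>))"
        using bound[of "of_int ((-1) ^ i * e) * cf_rev ?w y"] s unfolding ab by simp
      also have "(1 / s) powr (- 1 + \<delta>) = s powr (1 - \<delta>)"
        using s by (simp add: powr_divide powr_diff powr_add field_simps powr_minus)
      also have "C * exp (s powr (1 - \<delta>)) \<le> C * exp (A * real (Suc i) powr \<sigma>)"
        using s_pow C by (intro mult_left_mono) auto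
      finally have hb: "norm (h (of_int ((-1) ^ i * e) * cf_rev ?w y)) \<le> C * exp (A * real (Suc i) powr \<sigma>)" .
      have "2 powr ((real (Suc i) - 1) / 2) \<le> 2 powr (real (Suc i div 2))"
      proof (rule powr_mono)
        have "real (Suc i) \<le> 2 * real (Suc i div 2) + 1" by linarith
        then show "(real (Suc i) - 1) / 2 \<le> real (Suc i div 2)" by simp
      qed simp
      also have "\<dots> = 2 ^ (length ?w div 2)" by (simp add: powr_realpow del: div_Suc)
      also have "\<dots> \<le> cf_den y ?w" using cf_den_growth[OF ww(1)] y by auto
      finally have den: "2 powr ((real (Suc i) - 1) / 2) \<le> cf_den y ?w" .
      have "norm (coef \<theta> k e y ?w) = cf_den y ?w powr (- \<rho>)"
        unfolding \<rho>_def by (rule norm_coef) (use \<theta> ww y in auto)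
      also have "\<dots> \<le> (2 powr ((real (Suc i) - 1) / 2)) powr (- \<rho>)"
        using den k by (intro powr_mono2') (auto simp: \<rho>_def)
      also have "\<dots> = exp \<beta> * exp (- \<beta> * real (Suc i))"
        by (simp add: powr_powr powr_def \<beta>_def exp_add[symmetric] field_simps)
      finally have cb: "norm (coef \<theta> k e y ?w) \<le> exp \<beta> * exp (- \<beta> * real (Suc i))" .
      have "norm (t i) \<le> (exp \<beta> * exp (- \<beta> * real (Suc i))) * (C * exp (A * real (Suc i) powr \<sigma>))"
        unfolding t_def norm_mult by (intro mult_mono cb hb) auto
      also have "\<dots> = a (Suc i)"
        by (simp add: a_def exp_diff exp_minus exp_add field_simps)
      finally show ?thesis .
    qed
    have st: "summable (\<lambda>i. norm (t i))"
      by (rule summable_comparison_test'[OF sa, of 0]) (use t in auto)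
    have "norm (suminf t) \<le> (\<Sum>i. norm (t i))" by (rule summable_norm[OF st])
    also have "\<dots> \<le> (\<Sum>i. a (Suc i))" by (intro suminf_le t st sa)
    finally have "norm (suminf t) \<le> (\<Sum>i. a (Suc i))" .
    moreover have "(\<lambda>n. psum \<theta> k h e y (cf_prefix ?b n)) \<longlonglongrightarrow> suminf t"
    proof -
      have "\<theta> \<noteq> 0" using \<theta> by auto
      then have "psum \<theta> k h e y (cf_prefix ?b n) = (\<Sum>i<n. t i)" for n
        unfolding t_def by (intro psum_cf_prefix dig_ge1 zi) (use y in auto)
      then show ?thesis using summable_LIMSEQ[OF summable_norm_cancel[OF st]] by simp
    qed
    ultimately show "\<exists>r. norm r \<le> (\<Sum>i. a (Suc i)) \<and>
      (\<lambda>n. psum \<theta> k h e y (cf_prefix (dig z) n)) \<longlonglongrightarrow> r" by blast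
  qed
qed

lemma cf_conv_eq: "cf_conv x n = cf_val (cf_prefix (dig x) n) 0"
proof -
  have "(\<lambda>i. cf_digit x (0 + Suc i)) = dig x" by (auto simp: dig_def)
  then show ?thesis unfolding cf_conv_def cf_tail_eq by (simp only:)
qed

section \<open>From the reciprocity relation to the series\<close>

locale reciprocity =
  fixes k \<theta> :: complex and f :: "rat \<Rightarrow> complex" and h :: "real \<Rightarrow> complex"
  assumes k_pos: "Re k > 0"
    and \<theta>_norm: "norm \<theta> = 1"
    and f_per: "\<And>x. f (x + 1) = \<theta> * f x"
    and h_pos: "\<And>x::rat. x > 0 \<Longrightarrow>
        h (of_rat x) = f x - \<theta> ^ 3 * (of_real \<bar>of_rat x\<bar> :: complex) powr (-k) * f (-1/x)"
    and h_neg: "\<And>x::rat. x < 0 \<Longrightarrow>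
        h (of_rat x) = f x - \<theta> powi (-3) * (of_real \<bar>of_rat x\<bar> :: complex) powr (-k) * f (-1/x)"
begin

lemma \<theta>_nz: "\<theta> \<noteq> 0"
  using \<theta>_norm by auto

lemma f_per_nat: "f (x + of_nat n) = \<theta> ^ n * f x"
proof (induction n)
  case (Suc n)
  have "f (x + of_nat (Suc n)) = f ((x + of_nat n) + 1)" by (simp add: algebra_simps)
  then show ?case using Suc by (simp add: f_per)
qed simp

lemma f_per_int: "f (x + of_int n) = \<theta> powi n * f x"
proof (cases "0 \<le> n")
  case True
  then show ?thesis using f_per_nat[of x "nat n"] by (simp add: power_int_def)
next
  case False
  have "f x = \<theta> ^ nat (- n) * f (x + of_int n)"
    using f_per_nat[of "x + of_int n" "nat (- n)"] False by simp
  then show ?thesis using False \<theta>_nz by (simp add: power_int_def field_simps)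
qed

text \<open>For x = e [0; d + y] one has -1/x = -e y - e d. The integer shift contributes
  \<theta>^(-e d) and reciprocity \<theta>^(3 e); the total e(3 - d) is the negative of the
  increment in \<open>expo\<close>.\<close>

lemma f_reciprocity:
  assumes e: "e \<in> {-1, 1}" and d: "1 \<le> d" and y: "0 \<le> y"
  shows "f (of_int e * cf_step d y) = h (of_int e * of_rat (cf_step d y))
    + \<theta> powi (e * (3 - d)) * of_real (of_int d + of_rat y) powr k * f (- of_int e * y)"
proof -
  have dy: "0 < of_int d + y" using d y by (metis add_pos_nonneg of_int_0_less_iff zero_less_one_class.zero_less_one less_le_trans)
  define x where "x = of_int e * cf_step d y"
  have s: "0 < cf_step d y" using dy by (simp add: cf_step_def)
  have x: "real_of_rat x = of_int e * of_rat (cf_step d y)" by (simp add: x_def of_rat_mult)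
  have dyr: "0 < of_int d + real_of_rat y"
    using dy by (metis of_rat_add of_rat_of_int_eq zero_less_of_rat_iff)
  have ab: "\<bar>real_of_rat x\<bar> = inverse (of_int d + of_rat y)"
    using dyr e unfolding x by (auto simp: abs_mult cf_step_def of_rat_divide of_rat_add inverse_eq_divide)
  have pw: "(of_real \<bar>real_of_rat x\<bar> :: complex) powr (- k) = of_real (of_int d + of_rat y) powr k"
  proof -
    have "(of_real (inverse (of_int d + real_of_rat y)) :: complex) powr (- k)
        = inverse (of_real (of_int d + real_of_rat y) powr (- k))"
      using dyr by (simp add: powr_def Ln_of_real ln_inverse exp_minus del: of_real_add of_real_inverse)
    then show ?thesis unfolding ab by (simp add: powr_minus)
  qed
  have inv: "- 1 / x = - of_int e * y + of_int (- (e * d))"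
    using e dy by (auto simp: x_def cf_step_def field_simps)
  have fi: "f (- 1 / x) = \<theta> powi (- (e * d)) * f (- of_int e * y)"
    unfolding inv by (rule f_per_int)
  have "h (real_of_rat x) = f x - \<theta> powi (3 * e) * (of_real \<bar>of_rat x\<bar> :: complex) powr (-k) * f (-1/x)"
  proof -
    consider "e = 1" "x > 0" | "e = -1" "x < 0" using e s by (auto simp: x_def)
    then show ?thesis
    proof cases
      case 1
      have "\<theta> powi 3 = \<theta> ^ 3" using power_int_of_nat[of \<theta> 3] by simp
      then show ?thesis using h_pos[OF 1(2)] 1(1) by simp
    next
      case 2
      then show ?thesis using h_neg[OF 2(2)] by simp
    qed
  qed
  moreover have "\<theta> powi (3 * e) * \<theta> powi (- (e * d)) = \<theta> powi (e * (3 - d))"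
    using \<theta>_nz by (simp add: power_int_add[symmetric] algebra_simps)
  ultimately have "f x = h (real_of_rat x) + \<theta> powi (e * (3 - d)) * of_real (of_int d + of_rat y) powr k * f (- of_int e * y)"
    unfolding fi pw by (metis (no_types, lifting) diff_add_cancel add.commute mult.assoc mult.commute)
  then show ?thesis unfolding x unfolding x_def .
qed

text \<open>Telescoping: the new factor of \<open>coef\<close> is inverse to the factor in the
  reciprocity step, so each digit adds exactly one \<open>h\<close> term. The sign in front of the
  reversed fraction is +1 at odd length, as the definition of the limit requires.\<close>

lemma coef_f_eq_psum:
  assumes "word w"
  shows "coef \<theta> k 1 0 w * f (- ((-1) ^ length w) * cf_rev w 0) = f 0 + psum \<theta> k h 1 0 w"
  using assms
proof (induction w rule: rev_induct)
  case Nil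
  show ?case by simp
next
  case (snoc d w)
  then have w: "word w" "1 \<le> d" by auto
  define e :: int where "e = (-1) ^ length w"
  define y :: rat where "y = cf_rev w 0"
  have yr: "real_of_rat y = cf_rev w 0" using cf_rev_of_rat[of w 0] by (simp add: y_def)
  have "0 \<le> real_of_rat y" unfolding yr using w by (intro cf_rev_nonneg) auto
  then have y: "0 \<le> y" by simp
  have e: "e \<in> {-1, 1}" by (simp add: e_def) (metis minus_one_power_iff)
  let ?c = "coef \<theta> k 1 0"
  have cd: "?c (w @ [d]) = ?c w * (\<theta> powi (e * (d - 3)) * of_real (of_int d + real_of_rat y) powr (- k))"
    using coef_append[OF \<theta>_nz w(1), of "[d]" 0 k 1] w by (simp add: coef_def[of _ _ _ _ "[d]"] e_def yr)
  have dy: "0 < of_int d + real_of_rat y" using w y by (simp add: add_pos_nonneg)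
  have one: "(\<theta> powi (e * (d - 3)) * of_real (of_int d + real_of_rat y) powr (- k))
     * (\<theta> powi (e * (3 - d)) * of_real (of_int d + real_of_rat y) powr k) = 1"
  proof -
    have "\<theta> powi (e * (d - 3)) * \<theta> powi (e * (3 - d)) = 1"
      using \<theta>_nz by (simp add: power_int_add[symmetric] algebra_simps)
    moreover have "of_real (of_int d + real_of_rat y) powr (- k) * of_real (of_int d + real_of_rat y) powr k = (1::complex)"
      using dy by (simp add: powr_minus del: of_real_add) 
    ultimately show ?thesis by (simp add: algebra_simps del: of_real_add)
  qed
  have step: "cf_rev (w @ [d]) 0 = cf_step d y" by (simp add: y_def)
  have len: "- ((-1) ^ length (w @ [d])) = (of_int e :: rat)" by (simp add: e_def)
  have "?c (w @ [d]) * f (- ((-1) ^ length (w @ [d])) * cf_rev (w @ [d]) 0)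
      = ?c (w @ [d]) * f (of_int e * cf_step d y)"
    by (simp only: step len)
  also have "\<dots> = ?c (w @ [d]) * h (of_int e * of_rat (cf_step d y)) + ?c w * f (- of_int e * y)"
    unfolding f_reciprocity[OF e w(2) y] distrib_left
    using one by (simp add: cd mult.assoc del: of_real_add)
  also have "?c w * f (- of_int e * y) = f 0 + psum \<theta> k h 1 0 w"
    using snoc.IH[OF w(1)] by (simp add: y_def e_def)
  also have "of_rat (cf_step d y) = cf_rev (w @ [d]) (0::real)"
    by (simp add: yr[symmetric] cf_step_of_rat)
  finally show ?case
    using psum_snoc[OF \<theta>_nz snoc.prems, of 0 k h 1] by (simp add: e_def)
qed

lemma fstar_seq_eq_psum:
  assumes x: "x \<in> irr"
  shows "fstar_seq f \<theta> k x j = f 0 + psum \<theta> k h 1 0 (cf_prefix (dig x) (2 * j + 1))"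
proof -
  let ?w = "cf_prefix (dig x) (2 * j + 1)"
  have w: "word ?w" using x by (rule word_dig)
  have conv: "cf_conv x (2 * j + 1) = cf_val ?w 0" by (rule cf_conv_eq)
  \<comment> \<open>The constants -3 alternate in sign and cancel in pairs; one of them survives at
    odd length.\<close>
  have ex: "expo 1 (cf_prefix (dig x) n) = (if odd n then - 3 else 0) - (\<Sum>i=1..n. (-1)^i * cf_digit x i)" for n
  proof (induction n)
    case 0
    show ?case by (simp add: cf_prefix_def)
  next
    case (Suc n)
    have "expo 1 (cf_prefix (dig x) (Suc n)) = expo 1 (cf_prefix (dig x) n) + (-1) ^ n * (cf_digit x (Suc n) - 3)"
      by (simp add: cf_prefix_Suc expo_append dig_def[symmetric] del: One_nat_def)
    moreover have "(\<Sum>i=1..Suc n. (-1)^i * cf_digit x i) = (\<Sum>i=1..n. (-1)^i * cf_digit x i) - (-1) ^ n * cf_digit x (Suc n)"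
      by simp
    ultimately show ?case unfolding Suc by (cases "even n") simp_all
  qed
  have "coef \<theta> k 1 0 ?w = \<theta> powi (-3 - (\<Sum>i=1..2*j+1. (-1)^i * cf_digit x i)) * (of_int (rden (cf_conv x (2*j+1)))) powr (-k)"
  proof -
    have "of_int (rden (cf_conv x (2*j+1))) = cf_den 0 ?w"
      unfolding conv by (rule rden_rbar_cf_val(1)[OF w]) simp
    then have "of_real (cf_den 0 ?w) = (of_int (rden (cf_conv x (2*j+1))) :: complex)"
      by (metis of_real_of_int_eq)
    moreover have "expo 1 ?w = -3 - (\<Sum>i=1..2*j+1. (-1)^i * cf_digit x i)"
      unfolding ex by simp
    ultimately show ?thesis unfolding coef_def by (simp only:)
  qed
  moreover have "rbar (cf_conv x (2*j+1)) = - ((-1) ^ length ?w) * cf_rev ?w 0"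
    unfolding conv by (subst rden_rbar_cf_val(2)[OF w]) simp_all
  ultimately show ?thesis
    unfolding fstar_seq_def using coef_f_eq_psum[OF w] by (simp only:)
qed

end

section \<open>Level sets of positive measure\<close>

text \<open>The digits read last dominate the reversed fraction: a long prefix of an irrational in
  (a, b), read backwards, leads close to that point from any base point.\<close>

lemma cf_rev_steering:
  fixes a b :: real
  assumes "0 \<le> a" "a < b" "b \<le> 1"
  shows "\<exists>w d. word (w @ [d]) \<and> (\<forall>y\<in>{0..1}. cf_rev (w @ [d]) y \<in> {a<..<b})"
proof -
  obtain x where x: "a < x" "x < b" "x \<notin> \<rat>"
    using Rats_no_bot_less
    by (metis (no_types) assms(2) countable_rat uncountable_open_interval subsetI countable_subset greaterThanLessThan_iff)
  then have xi: "x \<in> irr" using assms by (auto simp: irr_def)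
  define e where "e = min (x - a) (b - x)"
  have e: "0 < e" using x by (simp add: e_def)
  obtain m where m: "(1/2) ^ m < e" using real_arch_pow_inv[OF e, of "1/2"] by auto
  \<comment> \<open>Being positive, n makes the word nonempty, so that a last digit can be split
    off.\<close>
  define n where "n = Suc m"
  define r where "r = cf_prefix (dig x) (2 * n)"
  have r: "word r" unfolding r_def by (rule word_dig[OF xi])
  obtain w d where wd: "rev r = w @ [d]" 
    by (metis r_def length_cf_prefix rev_exhaust rev_is_Nil_conv length_0_conv n_def nat.distinct(1) mult_eq_0_iff zero_neq_numeral)
  have "cf_rev (w @ [d]) y \<in> {a<..<b}" if y: "y \<in> {0..1}" for y
  proof -
    let ?T = "(gauss_map ^^ (2 * n)) x"
    have "?T \<in> irr" by (rule gauss_map_iterate_irr[OF xi])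
    then have "\<bar>cf_val r y - cf_val r ?T\<bar> \<le> 1 / (2 ^ (length r div 2))\<^sup>2"
      using y by (intro cf_val_contraction r) (auto simp: irr_def)
    also have "\<dots> = (1 / 2 ^ n)\<^sup>2" by (simp add: r_def power_divide)
    also have "\<dots> \<le> 1 / 2 ^ m"
    proof -
      have "(2::real) ^ m \<le> (2 ^ n)\<^sup>2"
        unfolding power_mult[symmetric] by (rule power_increasing) (auto simp: n_def)
      then show ?thesis unfolding power_divide by (simp add: frac_le)
    qed
    also have "\<dots> < e" using m by (simp add: power_divide)
    also have "cf_val r ?T = x" unfolding r_def by (rule cf_val_gauss[OF xi])
    also have "cf_val r y = cf_rev (w @ [d]) y" unfolding cf_val_rev wd ..
    finally show ?thesis by (auto simp: e_def)
  qed
  moreover have "word (w @ [d])" using r by (metis wd word_rev)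
  ultimately show ?thesis by blast
qed

text \<open>While d grows by a constant factor, \<kappa> ln(d + c) makes a full turn, and far out
  consecutive multiples of N change it by little. The bound \<open>D\<close> therefore serves all
  targets \<psi> and all shifts c.\<close>

lemma log_phase_steering:
  fixes \<kappa> \<tau> cm :: real and N :: nat and d0 :: int
  assumes \<kappa>: "\<kappa> \<noteq> 0" and N: "0 < N" and \<tau>: "0 < \<tau>" and cm: "0 \<le> cm"
  shows "\<exists>D. \<forall>\<psi> c. 0 \<le> c \<and> c \<le> cm \<longrightarrow> (\<exists>d m. d0 \<le> d \<and> d \<le> D \<and> int N dvd d \<and>
      \<bar>\<psi> - \<kappa> * ln (of_int d + c) - 2 * pi * of_int m\<bar> < \<tau>)"
proof -
  define R where "R = real N + cm"
  \<comment> \<open>For X \<ge> X0 the rounding error |\<kappa>| R/(X - R) is below \<tau>, and the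
    largest multiple of N up to X is at least d0.\<close>
  define X0 where "X0 = R + \<bar>real_of_int d0\<bar> + R * \<bar>\<kappa>\<bar> / \<tau> + 1"
  have R: "0 < R" "1 \<le> R" using N cm by (auto simp: R_def)
  have X0: "1 \<le> X0" using R \<tau> by (simp add: X0_def)
  define s1 where "s1 = ln X0 + 2 * pi / \<bar>\<kappa>\<bar>"
  show ?thesis
  proof (rule exI[of _ "\<lfloor>exp s1\<rfloor>"], intro allI impI)
    fix \<psi> c :: real assume c: "0 \<le> c \<and> c \<le> cm"
    \<comment> \<open>Number of full turns to remove so that s falls between ln X0 and s1; the sign
      of \<kappa> decides the rounding direction.\<close>
    define m where "m = (if 0 < \<kappa> then \<lfloor>(\<psi> - \<kappa> * ln X0) / (2 * pi)\<rfloor> else \<lceil>(\<psi> - \<kappa> * ln X0) / (2 * pi)\<rceil>)"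
    define s where "s = (\<psi> - 2 * pi * of_int m) / \<kappa>"
    define v where "v = (\<psi> - \<kappa> * ln X0) / (2 * pi)"
    have sv: "s - ln X0 = (2 * pi / \<kappa>) * (v - of_int m)"
      using \<kappa> by (simp add: s_def v_def field_simps)
    have vm: "0 < \<kappa> \<Longrightarrow> 0 \<le> v - of_int m \<and> v - of_int m \<le> 1" "\<kappa> < 0 \<Longrightarrow> -1 \<le> v - of_int m \<and> v - of_int m \<le> 0"
      unfolding m_def v_def by (auto; linarith)+
    have "0 \<le> s - ln X0 \<and> s - ln X0 \<le> 2 * pi / \<bar>\<kappa>\<bar>"
    proof (cases "0 < \<kappa>")
      case True
      have "0 \<le> (2 * pi / \<kappa>) * (v - of_int m)" using vm(1)[OF True] True by simp
      moreover have "(2 * pi / \<kappa>) * (v - of_int m) \<le> (2 * pi / \<kappa>) * 1"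
        using vm(1)[OF True] True by (intro mult_left_mono) auto
      ultimately show ?thesis using True unfolding sv by simp
    next
      case False
      then have neg: "\<kappa> < 0" using \<kappa> by simp
      then have eq: "(2 * pi / \<kappa>) * (v - of_int m) = (2 * pi / \<bar>\<kappa>\<bar>) * (of_int m - v)" by (simp add: field_simps)
      have "0 \<le> (2 * pi / \<bar>\<kappa>\<bar>) * (of_int m - v)" using vm(2)[OF neg] by simp
      moreover have "(2 * pi / \<bar>\<kappa>\<bar>) * (of_int m - v) \<le> (2 * pi / \<bar>\<kappa>\<bar>) * 1"
        using vm(2)[OF neg] by (intro mult_left_mono) auto
      ultimately show ?thesis unfolding sv eq by simp
    qed
    then have s: "ln X0 \<le> s" "s \<le> s1" by (auto simp: s1_def)
    define X where "X = exp s"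
    have XX0: "X0 \<le> X" using s(1) X0 exp_le_cancel_iff[of "ln X0" s] by (simp add: X_def)
    define d where "d = int N * \<lfloor>X / real N\<rfloor>"
    have d: "real_of_int d \<le> X" "X - real N < real_of_int d"
    proof -
      have "of_int \<lfloor>X / real N\<rfloor> \<le> X / real N" "X / real N - 1 < of_int \<lfloor>X / real N\<rfloor>" by linarith+
      then have "real N * of_int \<lfloor>X / real N\<rfloor> \<le> real N * (X / real N)"
        "real N * (X / real N - 1) < real N * of_int \<lfloor>X / real N\<rfloor>"
        using N by (simp_all only: mult_left_mono mult_strict_left_mono of_nat_0_le_iff of_nat_0_less_iff)
      then show "real_of_int d \<le> X" "X - real N < real_of_int d"
        using N by (auto simp: d_def right_diff_distrib)
    qed
    have dD: "d \<le> \<lfloor>exp s1\<rfloor>"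
    proof -
      have "X \<le> exp s1" using s by (simp add: X_def)
      then show ?thesis using d(1) by (simp add: le_floor_iff)
    qed
    have Rk: "0 \<le> R * \<bar>\<kappa>\<bar> / \<tau>" using R \<tau> by simp
    have "real_of_int d0 \<le> X - real N"
      using XX0 Rk R cm unfolding X0_def R_def by linarith
    then have d0: "d0 \<le> d" using d(2) by linarith
    have XR: "R * \<bar>\<kappa>\<bar> / \<tau> < X - R" "0 < X - R"
      using XX0 Rk unfolding X0_def by linarith+
    have dc: "X - R \<le> of_int d + c" "of_int d + c \<le> X + R" "0 < of_int d + c"
      using d c XR unfolding R_def by linarith+
    have "\<bar>ln (of_int d + c) - s\<bar> \<le> R / (X - R)"
    proof -
      have Xp: "0 < X" by (simp add: X_def)
      have "ln (of_int d + c) - ln X \<le> (of_int d + c) / X - 1"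
        using ln_le_minus_one[of "(of_int d + c) / X"] dc(3) Xp by (simp add: ln_div)
      also have "\<dots> = (of_int d + c - X) / X" using Xp by (simp add: diff_divide_distrib)
      also have "\<dots> \<le> R / X" using dc(2) Xp by (intro divide_right_mono) auto
      also have "\<dots> \<le> R / (X - R)" using R XR by (intro divide_left_mono) auto
      finally have 1: "ln (of_int d + c) - ln X \<le> R / (X - R)" .
      have "ln X - ln (of_int d + c) \<le> X / (of_int d + c) - 1"
        using ln_le_minus_one[of "X / (of_int d + c)"] dc(3) Xp by (simp add: ln_div)
      also have "\<dots> = (X - (of_int d + c)) / (of_int d + c)" using dc(3) by (simp add: diff_divide_distrib)
      also have "\<dots> \<le> R / (of_int d + c)" using dc by (intro divide_right_mono) auto
      also have "\<dots> \<le> R / (X - R)" using R XR dc by (intro divide_left_mono) auto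
      finally have 2: "ln X - ln (of_int d + c) \<le> R / (X - R)" .
      show ?thesis using 1 2 by (simp add: X_def)
    qed
    then have "\<bar>\<kappa>\<bar> * \<bar>ln (of_int d + c) - s\<bar> \<le> \<bar>\<kappa>\<bar> * (R / (X - R))" by (intro mult_left_mono) auto
    also have "\<dots> < \<tau>" using XR \<tau> by (simp add: field_simps)
    finally have "\<bar>\<kappa> * (ln (of_int d + c) - s)\<bar> < \<tau>" by (simp add: abs_mult)
    moreover have "\<psi> - \<kappa> * ln (of_int d + c) - 2 * pi * of_int m = - (\<kappa> * (ln (of_int d + c) - s))"
      using \<kappa> by (simp add: s_def field_simps)
    ultimately have "\<bar>\<psi> - \<kappa> * ln (of_int d + c) - 2 * pi * of_int m\<bar> < \<tau>" by simp
    moreover have "int N dvd d" by (simp add: d_def)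
    ultimately show "\<exists>d m. d0 \<le> d \<and> d \<le> \<lfloor>exp s1\<rfloor> \<and> int N dvd d \<and>
      \<bar>\<psi> - \<kappa> * ln (of_int d + c) - 2 * pi * of_int m\<bar> < \<tau>"
      using d0 dD by blast
  qed
qed

text \<open>For large d the window from a(d + 1) to b d - 1, with a = exp \<epsilon> and b = exp
  \<epsilon>', is longer than N and so meets the residue class of d. Its margins leave room for
  adding any y in [0,1] to both digits.\<close>

lemma ratio_steering:
  fixes \<epsilon> \<epsilon>' :: real and N :: nat
  assumes "0 < \<epsilon>" "\<epsilon> < \<epsilon>'" "0 < N"
  shows "\<exists>d0\<ge>1. \<forall>d\<ge>d0. \<exists>d'\<ge>d. of_int d' \<le> exp \<epsilon>' * of_int d \<and> int N dvd (d' - d) \<and>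
     (\<forall>y\<in>{0..1}. \<epsilon> < \<bar>ln ((of_int d + y) / (of_int d' + y))\<bar> \<and> \<bar>ln ((of_int d + y) / (of_int d' + y))\<bar> < \<epsilon>')"
proof -
  define a b where "a = exp \<epsilon>" and "b = exp \<epsilon>'"
  have ab: "1 < a" "a < b" using assms by (auto simp: a_def b_def)
  define d0 where "d0 = max 1 \<lceil>(real N + a + 2) / (b - a)\<rceil>"
  show ?thesis
  proof (rule exI[of _ d0], intro conjI allI impI)
    show "1 \<le> d0" by (simp add: d0_def)
    fix d assume d: "d0 \<le> d"
    then have d1: "1 \<le> d" by (simp add: d0_def)
    have "(real N + a + 2) / (b - a) \<le> of_int d0" by (simp add: d0_def) linarith
    also have "\<dots> \<le> of_int d" using d by simp
    finally have "real N + a + 2 \<le> of_int d * (b - a)" using ab by (simp add: field_simps)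
    then have gap: "a * (of_int d + 1) + real N < b * of_int d - 1" by (simp add: algebra_simps)
    \<comment> \<open>Yields the largest d' in the class of d not exceeding b d - 1.\<close>
    define j where "j = \<lfloor>(b * of_int d - 1 - of_int d) / real N\<rfloor>"
    define d' where "d' = d + int N * j"
    have "of_int j \<le> (b * of_int d - 1 - of_int d) / real N" "(b * of_int d - 1 - of_int d) / real N - 1 < of_int j"
      unfolding j_def by linarith+
    then have "real N * of_int j \<le> b * of_int d - 1 - of_int d" "b * of_int d - 1 - of_int d - real N < real N * of_int j"
      using assms(3) by (auto simp: field_simps)
    then have d': "real_of_int d' \<le> b * of_int d - 1" "b * of_int d - 1 - real N < real_of_int d'"
      by (auto simp: d'_def)
    have lo: "a * (of_int d + 1) < real_of_int d'" using d' gap by linarith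
    have "1 * real_of_int d \<le> a * (of_int d + 1)" using ab d1 by (intro mult_mono) auto
    then have dd': "d \<le> d'" using lo by linarith
    have "\<epsilon> < \<bar>ln ((of_int d + y) / (of_int d' + y))\<bar> \<and> \<bar>ln ((of_int d + y) / (of_int d' + y))\<bar> < \<epsilon>'"
      if y: "y \<in> {0..1}" for y
    proof -
      have pos: "0 < of_int d + y" "0 < of_int d' + y" using d1 dd' y by auto
      have "a * (of_int d + y) \<le> a * (of_int d + 1)" using ab y by (intro mult_left_mono) auto
      then have 1: "a * (of_int d + y) < of_int d' + y" using lo y by auto
      have "1 * y \<le> b * y" using ab y by (intro mult_right_mono) auto
      then have 2: "of_int d' + y < b * (of_int d + y)" using d' by (simp add: distrib_left)
      have l: "ln ((of_int d + y) / (of_int d' + y)) = ln (of_int d + y) - ln (of_int d' + y)" using pos by (simp add: ln_div)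
      have "ln (a * (of_int d + y)) < ln (of_int d' + y)" "ln (of_int d' + y) < ln (b * (of_int d + y))"
        using 1 2 pos ab by (auto intro!: ln_less_cancel_iff[THEN iffD2])
      moreover have "ln (a * (of_int d + y)) = \<epsilon> + ln (of_int d + y)" "ln (b * (of_int d + y)) = \<epsilon>' + ln (of_int d + y)"
        using pos by (simp_all add: ln_mult a_def b_def)
      ultimately show ?thesis using assms unfolding l by linarith
    qed
    moreover have "of_int d' \<le> exp \<epsilon>' * of_int d" using d' by (simp add: b_def)
    ultimately show "\<exists>d'\<ge>d. of_int d' \<le> exp \<epsilon>' * of_int d \<and> int N dvd (d' - d) \<and>
     (\<forall>y\<in>{0..1}. \<epsilon> < \<bar>ln ((of_int d + y) / (of_int d' + y))\<bar> \<and> \<bar>ln ((of_int d + y) / (of_int d' + y))\<bar> < \<epsilon>')"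
      using dd' by (intro exI[of _ d']) (auto simp: d'_def)
  qed
qed

section \<open>Combinatorics of a level set of positive measure\<close>

text \<open>All measure theory is condensed into \<open>hits\<close>: one \<open>u\<close> serves
  every word of the finite set, the unknown tails r share the bound \<open>M\<close>, and t is the
  level minus \<phi>(f 0). Both alternatives of the theorem are refuted from this alone.\<close>

locale level_set =
  fixes k \<theta> :: complex and h :: "real \<Rightarrow> complex" and \<phi> :: "complex \<Rightarrow> real" and M t :: real and N :: nat
  assumes k_pos: "0 < Re k"
    and N: "0 < N" "\<theta> ^ N = 1"
    and \<phi>_lin: "linear \<phi>"
    and hits: "\<And>W. finite W \<Longrightarrow> (\<And>w. w \<in> W \<Longrightarrow> word w) \<Longrightarrow> \<exists>u. word u \<and>
      (\<forall>w\<in>W. \<exists>r. norm r \<le> M \<and> \<phi> (psum \<theta> k h 1 0 (u @ w) + coef \<theta> k 1 0 (u @ w) * r) = t)"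
begin

text \<open>\<open>hit v\<close> is what remains of the existence of a point in the level set with prefix \<open>v\<close> and slow further
  digits; \<open>dir v\<close> is the phase of the coefficient reached after \<open>v\<close>.\<close>

definition hit :: "int list \<Rightarrow> bool" where
  "hit v \<longleftrightarrow> (\<exists>r. norm r \<le> M \<and> \<phi> (psum \<theta> k h 1 0 v + coef \<theta> k 1 0 v * r) = t)"

definition dir :: "int list \<Rightarrow> complex" where
  "dir v = \<theta> powi expo 1 v * cis (- Im k * ln (cf_den 0 v))"

lemma \<theta>_norm: "norm \<theta> = 1"
  using N by (metis norm_ge_zero norm_one norm_power power_eq_1_iff not_gr_zero gr_implies_not0)

lemma \<theta>_nz: "\<theta> \<noteq> 0"
  using \<theta>_norm by auto

lemma \<theta>_powi_cong: assumes "int N dvd a - b" shows "\<theta> powi a = \<theta> powi b"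
proof -
  obtain m where "a - b = int N * m" using assms by blast
  then have "\<theta> powi a = \<theta> powi (int N * m) * \<theta> powi b"
    using \<theta>_nz by (simp add: power_int_add[symmetric] algebra_simps)
  also have "\<theta> powi (int N * m) = 1" using N by (simp add: power_int_mult)
  finally show ?thesis by simp
qed

lemma norm_dir: "norm (dir v) = 1"
  by (simp add: dir_def norm_mult norm_power_int \<theta>_norm)

lemma coef_dir:
  assumes "word v"
  shows "coef \<theta> k 1 0 v = of_real (cf_den 0 v powr (- Re k)) * dir v"
proof -
  have q: "0 < cf_den 0 v" using cf_den_pos[OF assms, of 0] by simp
  have "(of_real (cf_den 0 v) :: complex) powr (- k) = exp (- k * of_real (ln (cf_den 0 v)))"
    using q by (simp add: powr_def Ln_of_real)
  also have "\<dots> = of_real (exp (- Re k * ln (cf_den 0 v))) * cis (- Im k * ln (cf_den 0 v))"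
    by (subst exp_eq_polar) simp
  also have "exp (- Re k * ln (cf_den 0 v)) = cf_den 0 v powr (- Re k)"
    using q by (simp add: powr_def)
  finally show ?thesis by (simp add: coef_def dir_def)
qed

lemma \<phi>_bounded: obtains L where "0 < L" "\<And>z. \<bar>\<phi> z\<bar> \<le> L * norm z"
proof -
  interpret bounded_linear \<phi> using \<phi>_lin by (simp add: linear_conv_bounded_linear)
  obtain K where "K > 0" "\<And>x. norm (\<phi> x) \<le> norm x * K" using pos_bounded by blast
  then show ?thesis using that[of K] by (simp add: mult.commute)
qed

lemma \<phi>_of_real_mult: "\<phi> (of_real a * z) = a * \<phi> z"
  using linear_scale[OF \<phi>_lin, of a z] by (simp add: scaleR_conv_of_real)

lemma cf_den_snoc: "cf_den 0 (v @ [d]) = cf_den 0 v * (of_int d + cf_rev v 0)"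
  by (simp add: cf_den_append)

lemma psum_snoc':
  "word (v @ [d]) \<Longrightarrow> psum \<theta> k h 1 0 (v @ [d]) = psum \<theta> k h 1 0 v
    + coef \<theta> k 1 0 (v @ [d]) * h ((-1) ^ length v * cf_step d (cf_rev v 0))"
  using psum_snoc[OF \<theta>_nz, of v d 0 k h 1] by simp

text \<open>The residual is \<phi> of the coefficient at \<open>v @ [D]\<close> times a quantity of
  norm at most H + M.\<close>

lemma residual_small:
  assumes hit: "hit (v @ [D])" and w: "word (v @ [D])"
    and L: "\<And>z. \<bar>\<phi> z\<bar> \<le> L * norm z" "0 < L"
    and H: "\<And>x. 0 < \<bar>x\<bar> \<Longrightarrow> \<bar>x\<bar> \<le> 1 \<Longrightarrow> norm (h x) \<le> H"
  shows "\<bar>t - \<phi> (psum \<theta> k h 1 0 v)\<bar> \<le> cf_den 0 v powr (- Re k) * (of_int D powr (- Re k) * (L * (H + M)))"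
proof -
  let ?x = "(-1) ^ length v * cf_step D (cf_rev v (0::real))" and ?c = "coef \<theta> k 1 0 (v @ [D])"
  have D: "1 \<le> D" "word v" using w by auto
  have y: "0 \<le> cf_rev v (0::real)" using D by (intro cf_rev_nonneg) auto
  have q: "0 < cf_den 0 v" using cf_den_pos[OF D(2), of 0] by simp
  obtain r where r: "norm r \<le> M" "\<phi> (psum \<theta> k h 1 0 (v @ [D]) + ?c * r) = t"
    using hit by (auto simp: hit_def)
  have "t = \<phi> (psum \<theta> k h 1 0 v + ?c * (h ?x + r))"
    using r(2) unfolding psum_snoc'[OF w] by (simp add: algebra_simps)
  then have "t - \<phi> (psum \<theta> k h 1 0 v) = \<phi> (?c * (h ?x + r))"
    by (simp add: linear_add[OF \<phi>_lin])
  then have "\<bar>t - \<phi> (psum \<theta> k h 1 0 v)\<bar> \<le> L * norm (?c * (h ?x + r))" using L by metis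
  also have "norm (?c * (h ?x + r)) \<le> norm ?c * (H + M)"
  proof -
    have "\<bar>?x\<bar> = cf_step D (cf_rev v (0::real))"
      using cf_step_pos[OF D(1) y] unfolding abs_mult power_abs by simp
    then have "norm (h ?x) \<le> H" using cf_step_pos[OF D(1) y] cf_step_le1[OF D(1) y] by (intro H) auto
    then have "norm (h ?x + r) \<le> H + M" using norm_triangle_ineq[of "h ?x" r] r by linarith
    then show ?thesis unfolding norm_mult by (intro mult_left_mono) auto
  qed
  also have "norm ?c = cf_den 0 v powr (- Re k) * (of_int D + cf_rev v 0) powr (- Re k)"
    using norm_coef[OF \<theta>_norm w, of 0 k 1] q y D by (simp add: cf_den_snoc powr_mult)
  also have "\<dots> * (H + M) \<le> (cf_den 0 v powr (- Re k) * of_int D powr (- Re k)) * (H + M)"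
  proof (intro mult_right_mono mult_left_mono powr_mono2')
    have "0 \<le> norm (h 1)" "0 \<le> norm r" by auto
    then show "0 \<le> H + M" using H[of 1] r by linarith
  qed (use y D k_pos in auto)
  finally show ?thesis using L(2) by (simp add: mult_ac)
qed

text \<open>The term at d is the difference of the residuals at \<open>v @ [d]\<close> and at
  \<open>v\<close>. Normalising by the denominator of \<open>v @ [d]\<close> magnifies the latter by
  (d + y)^(Re k), which is bounded since the last digits of words in \<open>W\<close> are.\<close>

lemma bounded_terms_vanish:
  assumes H: "\<And>x. 0 < \<bar>x\<bar> \<Longrightarrow> \<bar>x\<bar> \<le> 1 \<Longrightarrow> norm (h x) \<le> H"
    and W: "finite W" "\<And>w. w \<in> W \<Longrightarrow> word w" and \<eta>: "0 < \<eta>"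
  shows "\<exists>u. word u \<and> (\<forall>w d. w @ [d] \<in> W \<longrightarrow>
     \<bar>\<phi> (dir (u @ w @ [d]) * h ((-1) ^ length (u @ w) * cf_rev (u @ w @ [d]) 0))\<bar> \<le> \<eta>)"
proof -
  obtain L where L: "0 < L" "\<And>z. \<bar>\<phi> z\<bar> \<le> L * norm z" using \<phi>_bounded by blast
  define dm where "dm = Max (insert 1 (last ` W))"
  have dm: "1 \<le> dm" "\<And>w. w \<in> W \<Longrightarrow> last w \<le> dm" using W(1) by (auto simp: dm_def)
  \<comment> \<open>The power covers the magnified residual at \<open>v\<close>, the added 1 the one
    at \<open>v @ [d]\<close>.\<close>
  define G where "G = (real_of_int dm + 1) powr Re k + 1"
  have G: "0 < G" using powr_ge_zero[of "real_of_int dm + 1" "Re k"] unfolding G_def by linarith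
  have "((\<lambda>n. real n powr (- Re k) * (L * (H + M)) * G) \<longlongrightarrow> 0 * (L * (H + M)) * G) sequentially"
    using k_pos by (intro tendsto_intros tendsto_neg_powr filterlim_real_sequentially) auto
  then have "eventually (\<lambda>n. real n powr (- Re k) * (L * (H + M)) * G < \<eta>) sequentially"
    using \<eta> by (intro order_tendstoD(2)[of _ 0]) auto
  from eventually_conj[OF eventually_ge_at_top[of 1] this]
  obtain n where n: "1 \<le> n" "real n powr (- Re k) * (L * (H + M)) * G < \<eta>"
    using eventually_happens by fastforce
  define D where "D = int n"
  define \<gamma> where "\<gamma> = of_int D powr (- Re k) * (L * (H + M))"
  have \<gamma>: "\<gamma> * G < \<eta>" using n by (simp add: \<gamma>_def D_def)
  have D: "1 \<le> D" using n by (simp add: D_def)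
  \<comment> \<open>Both residuals need a trailing D: once in place of the last digit, once after
    it.\<close>
  define W' where "W' = (\<lambda>w. butlast w @ [D]) ` W \<union> (\<lambda>w. w @ [D]) ` W"
  have "word (butlast w)" if "w \<in> W" for w
    using W(2)[OF that] by (auto simp: word_def dest: in_set_butlastD)
  then have "word w" if "w \<in> W'" for w
    using that W(2) D by (auto simp: W'_def)
  moreover have "finite W'" using W(1) by (simp add: W'_def)
  ultimately obtain u where u: "word u" "\<And>w. w \<in> W' \<Longrightarrow> hit (u @ w)"
    using hits[of W'] unfolding hit_def by blast
  have "\<bar>\<phi> (dir (u @ w @ [d]) * h ((-1) ^ length (u @ w) * cf_rev (u @ w @ [d]) 0))\<bar> \<le> \<eta>"
    if wd: "w @ [d] \<in> W" for w d
  proof -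
    define v where "v = u @ w"
    have wv: "word v" "1 \<le> d" using W(2)[OF wd] u(1) by (auto simp: v_def)
    have "d \<le> dm" using dm(2)[OF wd] by simp
    have "w @ [D] \<in> W'" "w @ [d, D] \<in> W'" using wd by (force simp: W'_def)+
    then have hv: "hit (v @ [D])" "hit ((v @ [d]) @ [D])" using u(2) by (auto simp: v_def)
    let ?c = "coef \<theta> k 1 0 (v @ [d])" and ?x = "(-1) ^ length v * cf_rev (v @ [d]) 0"
    let ?q = "cf_den 0 v powr (- Re k)" and ?q' = "cf_den 0 (v @ [d]) powr (- Re k)"
    have y: "0 \<le> cf_rev v (0::real)" "cf_rev v (0::real) \<le> 1" using cf_rev_unit[OF wv(1), of 0] by auto
    have q: "0 < cf_den 0 v" "0 < cf_den 0 (v @ [d])" using cf_den_pos[of v 0] cf_den_pos[of "v @ [d]" 0] wv by auto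
    have r1: "\<bar>t - \<phi> (psum \<theta> k h 1 0 v)\<bar> \<le> ?q * \<gamma>"
      unfolding \<gamma>_def by (rule residual_small[OF hv(1) _ L(2,1) H]) (use wv D in auto)
    have r2: "\<bar>t - \<phi> (psum \<theta> k h 1 0 (v @ [d]))\<bar> \<le> ?q' * \<gamma>"
      unfolding \<gamma>_def by (rule residual_small[OF hv(2) _ L(2,1) H]) (use wv D in auto)
    have "psum \<theta> k h 1 0 (v @ [d]) = psum \<theta> k h 1 0 v + ?c * h ?x"
      using psum_snoc'[of v d] wv by simp
    then have "\<phi> (?c * h ?x) = \<phi> (psum \<theta> k h 1 0 (v @ [d])) - \<phi> (psum \<theta> k h 1 0 v)"
      by (simp add: linear_add[OF \<phi>_lin])
    then have "\<bar>\<phi> (?c * h ?x)\<bar> \<le> ?q * \<gamma> + ?q' * \<gamma>" using r1 r2 by linarith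
    also have "?q = ?q' * (of_int d + cf_rev v 0) powr Re k"
      using q y wv by (simp add: cf_den_snoc powr_mult powr_minus)
    also have "?c = of_real ?q' * dir (v @ [d])" using coef_dir[of "v @ [d]"] wv by simp
    finally have "\<bar>\<phi> (of_real ?q' * (dir (v @ [d]) * h ?x))\<bar> \<le> ?q' * (((of_int d + cf_rev v 0) powr Re k + 1) * \<gamma>)"
      by (simp add: algebra_simps)
    then have "?q' * \<bar>\<phi> (dir (v @ [d]) * h ?x)\<bar> \<le> ?q' * (((of_int d + cf_rev v 0) powr Re k + 1) * \<gamma>)"
      by (simp only: \<phi>_of_real_mult abs_mult abs_of_nonneg[OF powr_ge_zero])
    then have "\<bar>\<phi> (dir (v @ [d]) * h ?x)\<bar> \<le> ((of_int d + cf_rev v 0) powr Re k + 1) * \<gamma>"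
      using q by simp
    also have "\<dots> \<le> G * \<gamma>"
    proof (rule mult_right_mono)
      show "(of_int d + cf_rev v 0) powr Re k + 1 \<le> G"
        unfolding G_def using y wv \<open>d \<le> dm\<close> k_pos by (intro add_right_mono powr_mono2) auto
      have "0 \<le> ?q * \<gamma>" using r1 by linarith
      then show "0 \<le> \<gamma>" using q by (simp add: zero_le_mult_iff)
    qed
    finally show ?thesis using \<gamma> by (simp add: v_def mult.commute)
  qed
  then show ?thesis using u(1) by blast
qed

text \<open>One digit of bounded size, followed by any prescribed word, brings the phase into \<open>G\<close>.\<close>

definition steerable :: "(complex \<Rightarrow> bool) \<Rightarrow> bool" where
  "steerable G \<longleftrightarrow> (\<forall>r d0. word r \<longrightarrow>
     (\<exists>D. \<forall>v. word v \<longrightarrow> (\<exists>d. d0 \<le> d \<and> d \<le> D \<and> G (dir (v @ d # r)))))"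

text \<open>For real k the phase is a power of \<theta> with exponent X + s d, where s is 1 or -1
  and so its own inverse: d is taken congruent to s(p - X) modulo N.\<close>

lemma steerable_root:
  assumes "Im k = 0"
  shows "steerable (\<lambda>\<omega>. \<omega> = \<theta> powi p)"
  unfolding steerable_def
proof (intro allI impI)
  fix r :: "int list" and d0 :: int
  have "\<exists>d. d0 \<le> d \<and> d \<le> d0 + int N \<and> dir (v @ d # r) = \<theta> powi p" if "word v" for v
  proof -
    define s :: int where "s = (-1) ^ length v"
    define X where "X = expo 1 v - 3 * s + expo (- s) r"
    have s: "s * s = 1" by (simp add: s_def flip: power_add)
    define d where "d = d0 + (s * (p - X) - d0) mod int N"
    have "int N dvd (s * (p - X) - d)" unfolding d_def
      by (metis diff_diff_eq dvd_minus_mod)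
    then have "int N dvd s * (s * (p - X) - d)" by simp
    then have "int N dvd p - X - s * d" using s by (simp add: right_diff_distrib mult.assoc[symmetric])
    then have "int N dvd (X + s * d) - p" by (simp add: dvd_diff_commute algebra_simps)
    moreover have "expo 1 (v @ d # r) = X + s * d" by (simp add: expo_append X_def s_def algebra_simps)
    ultimately have "dir (v @ d # r) = \<theta> powi p" using assms by (simp add: dir_def \<theta>_powi_cong)
    moreover have "d0 \<le> d" "d \<le> d0 + int N" using N by (auto simp: d_def less_imp_le)
    ultimately show ?thesis by blast
  qed
  then show "\<exists>D. \<forall>v. word v \<longrightarrow> (\<exists>d. d0 \<le> d \<and> d \<le> D \<and> dir (v @ d # r) = \<theta> powi p)" by blast
qed

text \<open>A digit divisible by N freezes the power of \<theta>; the phase then moves only with the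
  logarithm of the denominator, which by \<open>cf_den_affine\<close> is a constant plus ln(d +
  c).\<close>

lemma steerable_phase:
  assumes "Im k \<noteq> 0" "0 < \<tau>"
  shows "steerable (\<lambda>\<omega>. \<exists>\<alpha>. \<bar>\<alpha> - \<beta>\<bar> < \<tau> \<and> \<omega> = cis (2 * pi * \<alpha>))"
  unfolding steerable_def
proof (intro allI impI)
  fix r :: "int list" and d0 :: int
  assume r: "word r"
  obtain A B where AB: "1 \<le> A" "0 \<le> B" "\<And>y. 0 \<le> y \<Longrightarrow> cf_den y r = A + B * y"
    using cf_den_affine[OF r] by auto
  obtain D where D: "\<And>\<psi> c. 0 \<le> c \<Longrightarrow> c \<le> 1 + B / A \<Longrightarrow> \<exists>d m. max 1 d0 \<le> d \<and> d \<le> D \<and> int N dvd d \<and>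
      \<bar>\<psi> - Im k * ln (of_int d + c) - 2 * pi * of_int m\<bar> < 2 * pi * \<tau>"
  proof -
    have "0 < 2 * pi * \<tau>" "0 \<le> 1 + B / A" using assms AB by auto
    from log_phase_steering[OF assms(1) N(1) this, of "max 1 d0"] that show ?thesis by blast
  qed
  have "\<exists>d. d0 \<le> d \<and> d \<le> D \<and> (\<exists>\<alpha>. \<bar>\<alpha> - \<beta>\<bar> < \<tau> \<and> dir (v @ d # r) = cis (2 * pi * \<alpha>))" if v: "word v" for v
  proof -
    define y :: real where "y = cf_rev v 0"
    have y: "0 \<le> y" "y \<le> 1" using cf_rev_unit[OF v, of 0] by (auto simp: y_def)
    define s :: int where "s = (-1) ^ length v"
    define X where "X = expo 1 v - 3 * s + expo (- s) r"
    \<comment> \<open>Its upper bound 1 + B/A is independent of \<open>v\<close>, and therefore so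
      is \<open>D\<close>.\<close>
    define c where "c = y + B / A"
    have c: "0 \<le> c" "c \<le> 1 + B / A" using y AB by (auto simp: c_def)
    have qv: "0 < cf_den 0 v" using cf_den_pos[OF v, of 0] by simp
    define a where "a = Arg (\<theta> powi X)"
    have "norm (\<theta> powi X) = 1" by (simp add: norm_power_int \<theta>_norm)
    then have a: "\<theta> powi X = cis a"
      using cis_Arg[of "\<theta> powi X"] \<theta>_nz by (simp add: a_def sgn_div_norm)
    obtain d m where dm: "max 1 d0 \<le> d" "d \<le> D" "int N dvd d"
      "\<bar>(a - Im k * ln (cf_den 0 v * A) - 2 * pi * \<beta>) - Im k * ln (of_int d + c) - 2 * pi * of_int m\<bar> < 2 * pi * \<tau>"
      using D[OF c] by blast
    have "cf_den y (d # r) = A * (of_int d + c)"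
      using AB(3)[of "cf_step d y"] y dm AB(1) cf_step_pos[of d y]
      by (simp add: cf_step_def c_def field_simps)
    then have "cf_den 0 (v @ d # r) = (cf_den 0 v * A) * (of_int d + c)"
      by (simp add: cf_den_append y_def)
    then have lnq: "ln (cf_den 0 (v @ d # r)) = ln (cf_den 0 v * A) + ln (of_int d + c)"
      using qv AB dm c by (simp add: ln_mult)
    have "expo 1 (v @ d # r) = X + s * d" by (simp add: expo_append X_def s_def algebra_simps)
    then have "\<theta> powi expo 1 (v @ d # r) = cis a"
      using \<theta>_powi_cong[of "X + s * d" X] dm(3) a by simp
    then have "dir (v @ d # r) = cis (a - Im k * (ln (cf_den 0 v * A) + ln (of_int d + c)))"
      by (simp add: dir_def lnq cis_mult)
    also have "\<dots> = cis (a - Im k * (ln (cf_den 0 v * A) + ln (of_int d + c)) - 2 * pi * of_int m)"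
      by (simp add: cis_divide[symmetric])
    finally have 1: "dir (v @ d # r) = cis (a - Im k * (ln (cf_den 0 v * A) + ln (of_int d + c)) - 2 * pi * of_int m)" .
    define \<alpha> where "\<alpha> = (a - Im k * (ln (cf_den 0 v * A) + ln (of_int d + c)) - 2 * pi * of_int m) / (2 * pi)"
    have \<alpha>pi: "2 * pi * \<alpha> = a - Im k * (ln (cf_den 0 v * A) + ln (of_int d + c)) - 2 * pi * of_int m"
      by (simp add: \<alpha>_def)
    have "2 * pi * (\<alpha> - \<beta>) = (a - Im k * ln (cf_den 0 v * A) - 2 * pi * \<beta>) - Im k * ln (of_int d + c) - 2 * pi * of_int m"
      unfolding right_diff_distrib \<alpha>pi by (simp add: distrib_left)
    then have "\<bar>2 * pi * (\<alpha> - \<beta>)\<bar> < 2 * pi * \<tau>" using dm(4) by simp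
    then have "\<bar>\<alpha> - \<beta>\<bar> < \<tau>" by (simp add: abs_mult)
    moreover have "dir (v @ d # r) = cis (2 * pi * \<alpha>)" unfolding \<alpha>pi by (rule 1)
    ultimately show ?thesis using dm by (meson max.bounded_iff)
  qed
  then show "\<exists>D. \<forall>v. word v \<longrightarrow> (\<exists>d. d0 \<le> d \<and> d \<le> D \<and> (\<exists>\<alpha>. \<bar>\<alpha> - \<beta>\<bar> < \<tau> \<and> dir (v @ d # r) = cis (2 * pi * \<alpha>)))" by blast
qed

text \<open>The parity of \<open>u\<close> determines the sign of the argument of \<open>h\<close>;
  an optional extra digit 1 corrects it.\<close>

lemma parity_prefix:
  assumes "\<sigma> \<in> {-1, 1::real}"
  obtains w where "w \<in> {[], [1]}" "(-1) ^ (length (u @ w) + n) = \<sigma>"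
proof (cases "(-1) ^ (length u + n) = \<sigma>")
  case True
  then show ?thesis using that[of "[]"] by simp
next
  case False
  then have "(-1) ^ (length (u @ [1]) + n) = \<sigma>"
    using assms by (cases "even (length u + n)") auto
  then show ?thesis using that[of "[1]"] by simp
qed

text \<open>The word that places the reversed fraction in (a, b) is fixed at the outset. It is
  preceded by a parity correction and a phase digit whose right values depend on \<open>u\<close>,
  so \<open>W\<close> lists all of them.\<close>

lemma no_bounded:
  assumes H: "\<And>x. 0 < \<bar>x\<bar> \<Longrightarrow> \<bar>x\<bar> \<le> 1 \<Longrightarrow> norm (h x) \<le> H"
    and G: "steerable G" and \<sigma>: "\<sigma> \<in> {-1, 1}" and ab: "0 \<le> a" "a < b" "b \<le> 1" and \<kappa>: "0 < \<kappa>"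
    and big: "\<And>y \<omega>. y \<in> {a<..<b} \<Longrightarrow> G \<omega> \<Longrightarrow> norm \<omega> = 1 \<Longrightarrow> \<kappa> \<le> \<bar>\<phi> (\<omega> * h (\<sigma> * y))\<bar>"
  shows False
proof -
  obtain w d where r: "word (w @ [d])" and st: "\<And>y. y \<in> {0..1} \<Longrightarrow> cf_rev (w @ [d]) y \<in> {a<..<b}"
    using cf_rev_steering[OF ab] by blast
  obtain D where D: "\<And>v. word v \<Longrightarrow> \<exists>c. 1 \<le> c \<and> c \<le> D \<and> G (dir (v @ c # (w @ [d])))"
    using G r unfolding steerable_def by blast
  define W where "W = (\<lambda>(p, c). (p @ c # w) @ [d]) ` ({[], [1]} \<times> {1..D})"
  have "finite W" by (simp add: W_def)
  moreover have "word x" if "x \<in> W" for x using that r by (auto simp: W_def)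
  ultimately obtain u where u: "word u" and small: "\<And>w d. w @ [d] \<in> W \<Longrightarrow>
     \<bar>\<phi> (dir (u @ w @ [d]) * h ((-1) ^ length (u @ w) * cf_rev (u @ w @ [d]) 0))\<bar> \<le> \<kappa> / 2"
    using bounded_terms_vanish[OF H, of W "\<kappa> / 2"] \<kappa> by auto
  obtain p where p: "p \<in> {[], [1]}" "(-1) ^ (length (u @ p) + Suc (length w)) = \<sigma>"
    using parity_prefix[OF \<sigma>] by blast
  have wp: "word (u @ p)" using u p by auto
  obtain c where c: "1 \<le> c" "c \<le> D" "G (dir ((u @ p) @ c # (w @ [d])))" using D[OF wp] by blast
  have mem: "(p @ c # w) @ [d] \<in> W" unfolding W_def using p c by (intro image_eqI[of _ _ "(p, c)"]) auto
  define y where "y = cf_rev (u @ (p @ c # w) @ [d]) (0::real)"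
  have wc: "word ((u @ p) @ [c])" using wp c by simp
  have "cf_rev ((u @ p) @ [c]) (0::real) \<in> {0..1}"
    using cf_rev_unit[OF wc, of 0] by simp
  from st[OF this] have y: "y \<in> {a<..<b}" by (simp add: y_def)
  have "(-1) ^ length (u @ (p @ c # w)) = \<sigma>" using p(2) by (simp add: add.assoc)
  then have "\<bar>\<phi> (dir (u @ (p @ c # w) @ [d]) * h (\<sigma> * y))\<bar> \<le> \<kappa> / 2"
    using small[OF mem] unfolding y_def by simp
  moreover have "\<kappa> \<le> \<bar>\<phi> (dir (u @ (p @ c # w) @ [d]) * h (\<sigma> * y))\<bar>"
    by (rule big[OF y]) (use c(3) norm_dir in auto)
  ultimately show False using \<kappa> by linarith
qed

text \<open>Two hits share the prefix \<open>v\<close> and continue with d and d'. Subtraction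
  cancels the level and the sum over \<open>v\<close>, and equates \<phi> of the rotated difference
  of \<open>h\<close> values with \<phi> of a bounded difference of tails, which is impossible for
  tiny x.\<close>

lemma no_unbounded:
  assumes G: "steerable G" and \<sigma>: "\<sigma> \<in> {-1, 1}" and \<epsilon>: "0 < \<epsilon>" "\<epsilon> < \<epsilon>'" "\<epsilon>' \<le> 1"
    and \<kappa>: "0 < \<kappa>" and x0: "0 < x0"
    and big: "\<And>x u \<omega>. 0 < x \<Longrightarrow> x < x0 \<Longrightarrow> 0 < u \<Longrightarrow> \<epsilon> < \<bar>ln u\<bar> \<Longrightarrow> \<bar>ln u\<bar> < \<epsilon>' \<Longrightarrow> G \<omega> \<Longrightarrow>
       \<kappa> * norm (h (\<sigma> * x)) \<le> \<bar>\<phi> (\<omega> * (h (\<sigma> * x) - of_real u powr k * h (u * (\<sigma> * x))))\<bar>"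
    and inf: "\<And>B. \<exists>x1>0. \<forall>x. 0 < x \<and> x < x1 \<longrightarrow> B \<le> norm (h (\<sigma> * x))"
  shows False
proof -
  obtain L where L: "0 < L" "\<And>z. \<bar>\<phi> z\<bar> \<le> L * norm z" using \<phi>_bounded by blast
  \<comment> \<open>The second tail carries u^k, of modulus at most exp(Re k) because |ln u| <
    1.\<close>
  define E where "E = L * (M + exp (Re k) * M)"
  \<comment> \<open>The summand 1 makes the final comparison strict: \<kappa>(E/\<kappa> + 1) = E +
    \<kappa>.\<close>
  obtain x1 where x1: "0 < x1" "\<And>x. 0 < x \<Longrightarrow> x < x1 \<Longrightarrow> E / \<kappa> + 1 \<le> norm (h (\<sigma> * x))"
    using inf[of "E / \<kappa> + 1"] by blast
  obtain d1 where d1: "1 \<le> d1" and ratio: "\<And>d. d1 \<le> d \<Longrightarrow> \<exists>d'\<ge>d. of_int d' \<le> exp \<epsilon>' * of_int d \<and> int N dvd (d' - d) \<and>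
     (\<forall>y\<in>{0..1}. \<epsilon> < \<bar>ln ((of_int d + y) / (of_int d' + y))\<bar> \<and> \<bar>ln ((of_int d + y) / (of_int d' + y))\<bar> < \<epsilon>')"
    using ratio_steering[OF \<epsilon>(1,2) N(1)] by blast
  define d0 where "d0 = max d1 (\<lceil>1 / min x0 x1\<rceil> + 1)"
  obtain D where D: "\<And>v. word v \<Longrightarrow> \<exists>d. d0 \<le> d \<and> d \<le> D \<and> G (dir (v @ [d]))"
    using G unfolding steerable_def by (metis word_Nil)
  \<comment> \<open>Bounds the partner d' of every admissible d, so that both digits can be listed
    before \<open>v\<close> is known.\<close>
  define D' where "D' = \<lceil>exp \<epsilon>' * of_int D\<rceil>"
  define W where "W = (\<lambda>(p, d). p @ [d]) ` ({[], [1]} \<times> {1..max D D'})"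
  have "finite W" by (simp add: W_def)
  moreover have "word x" if "x \<in> W" for x using that by (auto simp: W_def)
  ultimately obtain u0 where u0: "word u0" and hit: "\<And>w. w \<in> W \<Longrightarrow> hit (u0 @ w)"
    using hits[of W] unfolding hit_def by blast
  obtain p where p: "p \<in> {[], [1]}" "(-1) ^ (length (u0 @ p) + 0) = \<sigma>"
    using parity_prefix[OF \<sigma>] by blast
  define v where "v = u0 @ p"
  have v: "word v" "(-1) ^ length v = \<sigma>" using u0 p by (auto simp: v_def)
  obtain d where d: "d0 \<le> d" "d \<le> D" "G (dir (v @ [d]))" using D[OF v(1)] by blast
  have dd1: "d1 \<le> d" "1 \<le> d" using d d1 by (auto simp: d0_def)
  obtain d' where d': "d \<le> d'" "of_int d' \<le> exp \<epsilon>' * of_int d" "int N dvd (d' - d)"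
    and lnr: "\<And>y. y \<in> {0..1} \<Longrightarrow> \<epsilon> < \<bar>ln ((of_int d + y) / (of_int d' + y))\<bar> \<and> \<bar>ln ((of_int d + y) / (of_int d' + y))\<bar> < \<epsilon>'"
    using ratio[OF dd1(1)] by blast
  have "of_int d' \<le> exp \<epsilon>' * of_int D"
  proof -
    have "exp \<epsilon>' * of_int d \<le> exp \<epsilon>' * of_int D" using d by (intro mult_left_mono) auto
    then show ?thesis using d'(2) by linarith
  qed
  then have "d' \<le> D'" unfolding D'_def by linarith
  then have "(p, d) \<in> {[], [1]} \<times> {1..max D D'}" "(p, d') \<in> {[], [1]} \<times> {1..max D D'}"
    using p d d' dd1 by auto
  then have "p @ [d] \<in> W" "p @ [d'] \<in> W" unfolding W_def by force+
  then have hd: "hit (v @ [d])" "hit (v @ [d'])" using hit by (auto simp: v_def)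
  define y :: real where "y = cf_rev v 0"
  have y: "0 \<le> y" "y \<le> 1" using cf_rev_unit[OF v(1), of 0] by (auto simp: y_def)
  define x where "x = cf_step d y"
  define u where "u = (of_int d + y) / (of_int d' + y)"
  have pos: "0 < of_int d + y" "0 < of_int d' + y" using dd1 d'(1) y by auto
  have u: "0 < u" "\<epsilon> < \<bar>ln u\<bar>" "\<bar>ln u\<bar> < \<epsilon>'" using pos lnr[of y] y by (auto simp: u_def)
  have ux: "cf_step d' y = u * x" using pos by (simp add: cf_step_def u_def x_def)
  have wd: "word (v @ [d])" "word (v @ [d'])" using v dd1 d'(1) by auto
  define q where "q = cf_den 0 (v @ [d]) powr (- Re k)"
  have q: "0 < q" using cf_den_pos[OF wd(1), of 0] by (simp add: q_def)
  have cd: "coef \<theta> k 1 0 (v @ [d]) = of_real q * dir (v @ [d])"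
    unfolding q_def by (rule coef_dir[OF wd(1)])
  \<comment> \<open>As d and d' agree modulo N, the powers of \<theta> coincide and only the ratio u
    of the denominators remains.\<close>
  have cd': "coef \<theta> k 1 0 (v @ [d']) = coef \<theta> k 1 0 (v @ [d]) * of_real u powr k"
  proof -
    have qv: "0 < cf_den 0 v" using cf_den_pos[OF v(1), of 0] by simp
    have "cf_den 0 (v @ [d]) = cf_den 0 (v @ [d']) * u"
      using pos by (simp add: cf_den_snoc y_def[symmetric] u_def)
    moreover have "0 < cf_den 0 (v @ [d'])" using cf_den_pos[OF wd(2), of 0] by simp
    ultimately have "(of_real (cf_den 0 (v @ [d])) :: complex) powr (- k) = of_real (cf_den 0 (v @ [d'])) powr (- k) * of_real u powr (- k)"
      using powr_of_real_mult[of "cf_den 0 (v @ [d'])" u "- k"] u(1) by (simp only:)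
    then have "(of_real (cf_den 0 (v @ [d'])) :: complex) powr (- k) = of_real (cf_den 0 (v @ [d])) powr (- k) * of_real u powr k"
      using u(1) by (simp add: powr_minus)
    moreover have "\<theta> powi expo 1 (v @ [d']) = \<theta> powi expo 1 (v @ [d])"
    proof (rule \<theta>_powi_cong)
      have "expo 1 (v @ [d']) - expo 1 (v @ [d]) = (-1) ^ length v * (d' - d)"
        by (simp add: expo_append algebra_simps)
      then show "int N dvd expo 1 (v @ [d']) - expo 1 (v @ [d])" using d'(3) by simp
    qed
    ultimately show ?thesis by (simp add: coef_def)
  qed
  let ?P = "psum \<theta> k h 1 0 v" and ?\<omega> = "dir (v @ [d])"
  obtain r where r: "norm r \<le> M" "\<phi> (?P + of_real q * (?\<omega> * (h (\<sigma> * x) + r))) = t"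
    using hd(1) unfolding hit_def psum_snoc'[OF wd(1)] cd by (auto simp: v(2) x_def y_def algebra_simps)
  obtain r' where r': "norm r' \<le> M" "\<phi> (?P + of_real q * (?\<omega> * (of_real u powr k * (h (\<sigma> * (u * x)) + r')))) = t"
    using hd(2) unfolding hit_def psum_snoc'[OF wd(2)] cd' cd y_def[symmetric] ux by (auto simp: v(2) algebra_simps)
  have "q * \<phi> (?\<omega> * (h (\<sigma> * x) + r)) = q * \<phi> (?\<omega> * (of_real u powr k * (h (\<sigma> * (u * x)) + r')))"
    using r(2) r'(2) by (simp only: linear_add[OF \<phi>_lin] \<phi>_of_real_mult)
  then have "\<phi> (?\<omega> * (h (\<sigma> * x) + r)) = \<phi> (?\<omega> * (of_real u powr k * (h (\<sigma> * (u * x)) + r')))"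
    using q by simp
  moreover have "\<phi> (?\<omega> * (h (\<sigma> * x) - of_real u powr k * h (u * (\<sigma> * x)))) - \<phi> (?\<omega> * (of_real u powr k * r' - r))
      = \<phi> (?\<omega> * (h (\<sigma> * x) + r)) - \<phi> (?\<omega> * (of_real u powr k * (h (\<sigma> * (u * x)) + r')))"
    by (simp add: linear_diff[OF \<phi>_lin, symmetric] algebra_simps)
  ultimately have "\<phi> (?\<omega> * (h (\<sigma> * x) - of_real u powr k * h (u * (\<sigma> * x)))) = \<phi> (?\<omega> * (of_real u powr k * r' - r))"
    by simp
  also have "\<bar>\<dots>\<bar> \<le> L * norm (?\<omega> * (of_real u powr k * r' - r))" by (rule L)
  also have "\<dots> \<le> E"
  proof -
    have "norm (of_real u powr k :: complex) = u powr Re k" using u(1) by (simp add: norm_powr_real_powr)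
    also have "\<dots> = exp (Re k * ln u)" using u(1) by (simp add: powr_def)
    also have "\<dots> \<le> exp (Re k)" 
    proof -
      have "ln u \<le> 1" using u \<epsilon> by linarith
      then show ?thesis using k_pos by simp
    qed
    finally have "norm (of_real u powr k * r') \<le> exp (Re k) * M"
      using r' unfolding norm_mult by (intro mult_mono) auto
    then have "norm (of_real u powr k * r' - r) \<le> M + exp (Re k) * M"
      using norm_triangle_ineq4[of "of_real u powr k * r'" r] r by linarith
    then show ?thesis using L(1) by (simp add: E_def norm_mult norm_dir)
  qed
  finally have up: "\<bar>\<phi> (?\<omega> * (h (\<sigma> * x) - of_real u powr k * h (u * (\<sigma> * x))))\<bar> \<le> E" .
  have x: "0 < x" "x < x0" "x < x1"
  proof -
    have "1 / min x0 x1 < of_int d0" unfolding d0_def by linarith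
    also have "\<dots> \<le> of_int d + y" using d y by simp
    finally have "1 / min x0 x1 < of_int d + y" .
    moreover have "0 < min x0 x1" using x0 x1(1) by simp
    ultimately have "x < min x0 x1"
      using pos unfolding x_def cf_step_def by (metis divide_less_eq mult.commute pos_divide_less_eq)
    then show "x < x0" "x < x1" by auto
    show "0 < x" using pos by (simp add: x_def cf_step_def)
  qed
  have "\<kappa> * (E / \<kappa> + 1) \<le> \<kappa> * norm (h (\<sigma> * x))" using \<kappa> x1(2)[of x] x by (intro mult_left_mono) auto
  also have "\<dots> \<le> E" using big[OF x(1,2) u d(3)] up by linarith
  finally show False using \<kappa> by (simp add: distrib_left)
qed

end

section \<open>Existence and absence of atoms\<close>

lemma exists_small_less_powr:
  assumes "0 < (\<epsilon>0::real)"
  shows "\<exists>\<epsilon>>0. \<epsilon> < \<epsilon>0 \<and> \<epsilon> < \<epsilon> powr (2/3) \<and> \<epsilon> powr (2/3) \<le> 1"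
proof (intro exI conjI)
  let ?\<epsilon> = "min (\<epsilon>0 / 2) (1 / 2)"
  show "0 < ?\<epsilon>" "?\<epsilon> < \<epsilon>0" using assms by auto
  then show "?\<epsilon> powr (2/3) \<le> 1" by (intro powr_le1) auto
  have "?\<epsilon> powr 1 < ?\<epsilon> powr (2/3)" using \<open>0 < ?\<epsilon>\<close> by (intro powr_less_mono') auto
  then show "?\<epsilon> < ?\<epsilon> powr (2/3)" using \<open>0 < ?\<epsilon>\<close> by simp
qed

lemma eventually_gt_of_Liminf_pos:
  assumes "Liminf F X > (0::ereal)"
  shows "\<exists>\<kappa>>0. eventually (\<lambda>x. ereal \<kappa> < X x) F"
  using ereal_dense2[OF assms] less_LiminfD by fastforce

lemma e1_eq_cis: "e1 \<alpha> = cis (2 * pi * \<alpha>)"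
  by (simp add: e1_def cis_conv_exp mult_ac)

section \<open>Exclusion of the continuous and the singular case\<close>

context level_set
begin

text \<open>The window for y begins just beyond |\<alpha>|, so it avoids 0, where \<open>g\<close>
  and \<open>h\<close> may differ, even for \<alpha> = 0. Continuity of \<open>g\<close> costs half
  of \<kappa>.\<close>

lemma no_continuous:
  assumes g: "continuous_on {-1..1} g" "\<And>x. x \<in> {-1..1} \<Longrightarrow> x \<noteq> 0 \<Longrightarrow> g x = h x"
    and \<alpha>: "\<alpha> \<in> {-1<..<1}" and G: "steerable G" and \<kappa>: "0 < \<kappa>"
    and big: "\<And>\<omega>. G \<omega> \<Longrightarrow> \<kappa> \<le> \<bar>\<phi> (\<omega> * g \<alpha>)\<bar>"
  shows False
proof -
  obtain L where L: "0 < L" "\<And>z. \<bar>\<phi> z\<bar> \<le> L * norm z" using \<phi>_bounded by blast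
  have "bounded (g ` {-1..1})" using g(1) by (intro compact_imp_bounded compact_continuous_image) auto
  then obtain H where H: "\<And>x. x \<in> {-1..1} \<Longrightarrow> norm (g x) \<le> H" unfolding bounded_iff by blast
  obtain e where e: "0 < e" "\<And>x. x \<in> {-1..1} \<Longrightarrow> \<bar>x - \<alpha>\<bar> < e \<Longrightarrow> norm (g x - g \<alpha>) < \<kappa> / (2 * L)"
    using g(1) \<alpha> \<kappa> L(1) unfolding continuous_on_iff dist_norm
    by (metis atLeastAtMost_iff greaterThanLessThan_iff half_gt_zero divide_pos_pos less_imp_le real_norm_def mult_pos_pos zero_less_numeral)
  define \<sigma> :: real where "\<sigma> = (if 0 \<le> \<alpha> then 1 else -1)"
  have \<sigma>: "\<sigma> \<in> {-1, 1}" "\<sigma> * \<bar>\<alpha>\<bar> = \<alpha>" by (auto simp: \<sigma>_def)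
  show False
  proof (rule no_bounded[OF _ G \<sigma>(1), of H "\<bar>\<alpha>\<bar>" "min 1 (\<bar>\<alpha>\<bar> + e)" "\<kappa> / 2"])
    fix x :: real assume "0 < \<bar>x\<bar>" "\<bar>x\<bar> \<le> 1"
    then have "x \<in> {-1..1}" "x \<noteq> 0" by auto
    then show "norm (h x) \<le> H" using H g(2) by metis
  next
    fix y \<omega> assume y: "y \<in> {\<bar>\<alpha>\<bar><..<min 1 (\<bar>\<alpha>\<bar> + e)}" and \<omega>: "G \<omega>" "norm \<omega> = 1"
    have x: "\<sigma> * y \<in> {-1..1}" "\<sigma> * y \<noteq> 0" "\<bar>\<sigma> * y - \<alpha>\<bar> < e" using y by (auto simp: \<sigma>_def)
    have "\<bar>\<phi> (\<omega> * (h (\<sigma> * y) - g \<alpha>))\<bar> \<le> L * norm (\<omega> * (h (\<sigma> * y) - g \<alpha>))" by (rule L)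
    also have "\<dots> \<le> L * (\<kappa> / (2 * L))"
      using e(2)[OF x(1,3)] g(2)[OF x(1,2)] \<omega>(2) L(1) by (intro mult_left_mono) (auto simp: norm_mult)
    also have "\<dots> = \<kappa> / 2" using L(1) by simp
    finally have "\<bar>\<phi> (\<omega> * h (\<sigma> * y)) - \<phi> (\<omega> * g \<alpha>)\<bar> \<le> \<kappa> / 2"
      by (simp add: linear_diff[OF \<phi>_lin] right_diff_distrib)
    then show "\<kappa> / 2 \<le> \<bar>\<phi> (\<omega> * h (\<sigma> * y))\<bar>" using big[OF \<omega>(1)] by linarith
  qed (use \<alpha> \<kappa> e(1) in auto)
qed

lemma no_continuous_real:
  assumes g: "continuous_on {-1..1} g" "\<And>x. x \<in> {-1..1} \<Longrightarrow> x \<noteq> 0 \<Longrightarrow> g x = h x"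
    and \<alpha>: "\<alpha> \<in> {-1<..<1}" and k: "Im k = 0" and nz: "\<phi> (\<theta> powi p * g \<alpha>) \<noteq> 0"
  shows False
  by (rule no_continuous[OF g \<alpha> steerable_root[OF k, of p], of "\<bar>\<phi> (\<theta> powi p * g \<alpha>)\<bar>"]) (use nz in auto)

text \<open>If \<phi>(z) is nonzero, rotation by some angle turns g(\<alpha>) into a positive
  multiple of z; by continuity \<phi> stays away from 0 at nearby angles, which can be reached by
  steering.\<close>

lemma no_continuous_nonreal:
  assumes g: "continuous_on {-1..1} g" "\<And>x. x \<in> {-1..1} \<Longrightarrow> x \<noteq> 0 \<Longrightarrow> g x = h x"
    and \<alpha>: "\<alpha> \<in> {-1<..<1}" and k: "Im k \<noteq> 0" and nz: "g \<alpha> \<noteq> 0" and \<phi>_nz: "\<phi> \<noteq> (\<lambda>_. 0)"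
  shows False
proof -
  obtain z where z: "\<phi> z \<noteq> 0" using \<phi>_nz by auto
  then have z0: "z \<noteq> 0" using linear_0[OF \<phi>_lin] by auto
  define \<beta> where "\<beta> = Arg (z / g \<alpha>) / (2 * pi)"
  have "cis (2 * pi * \<beta>) = sgn (z / g \<alpha>)" using cis_Arg[of "z / g \<alpha>"] z0 nz by (simp add: \<beta>_def)
  then have "cis (2 * pi * \<beta>) * g \<alpha> = of_real (norm (g \<alpha>) / norm z) * z"
    using nz by (simp add: sgn_div_norm scaleR_conv_of_real norm_divide)
  then have "\<phi> (cis (2 * pi * \<beta>) * g \<alpha>) = (norm (g \<alpha>) / norm z) * \<phi> z"
    by (simp only: \<phi>_of_real_mult)
  then have ne: "\<phi> (cis (2 * pi * \<beta>) * g \<alpha>) \<noteq> 0" using z z0 nz by simp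
  define \<kappa> where "\<kappa> = \<bar>\<phi> (cis (2 * pi * \<beta>) * g \<alpha>)\<bar> / 2"
  have \<kappa>: "0 < \<kappa>" using ne by (simp add: \<kappa>_def)
  have "isCont \<phi> z" for z
    using \<phi>_lin by (simp add: linear_continuous_at linear_conv_bounded_linear)
  moreover have "isCont (\<lambda>a. cis (2 * pi * a) * g \<alpha>) \<beta>"
    unfolding isCont_def by (intro tendsto_intros)
  ultimately have "isCont (\<lambda>a. \<phi> (cis (2 * pi * a) * g \<alpha>)) \<beta>"
    by (rule isCont_o2[rotated])
  then have "(\<lambda>a. \<bar>\<phi> (cis (2 * pi * a) * g \<alpha>)\<bar>) \<midarrow>\<beta>\<rightarrow> \<bar>\<phi> (cis (2 * pi * \<beta>) * g \<alpha>)\<bar>"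
    unfolding isCont_def by (rule tendsto_rabs)
  then have "eventually (\<lambda>a. \<kappa> < \<bar>\<phi> (cis (2 * pi * a) * g \<alpha>)\<bar>) (at \<beta>)"
    by (rule order_tendstoD(1)) (use ne in \<open>simp add: \<kappa>_def\<close>)
  then obtain \<tau> where \<tau>: "0 < \<tau>" "\<And>a. a \<noteq> \<beta> \<Longrightarrow> \<bar>a - \<beta>\<bar> < \<tau> \<Longrightarrow> \<kappa> < \<bar>\<phi> (cis (2 * pi * a) * g \<alpha>)\<bar>"
    unfolding eventually_at dist_real_def by auto
  have "\<kappa> \<le> \<bar>\<phi> (cis (2 * pi * a) * g \<alpha>)\<bar>" if "\<bar>a - \<beta>\<bar> < \<tau>" for a
    using \<tau>(2)[OF _ that] \<kappa> by (cases "a = \<beta>") (auto simp: \<kappa>_def)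
  then show False
    by (intro no_continuous[OF g \<alpha> steerable_phase[OF k \<tau>(1), of \<beta>] \<kappa>]) auto
qed

text \<open>Replaces the one-sided filter by a sign \<sigma> and thresholds for x > 0, and clears
  the division by |h|.\<close>

lemma no_singular:
  assumes F: "F = at_right (0::real) \<or> F = at_left 0"
    and top: "filterlim (\<lambda>x. norm (h x)) at_top F"
    and \<epsilon>: "0 < \<epsilon>" "\<epsilon> < \<epsilon>'" "\<epsilon>' \<le> 1" and G: "steerable G" and \<kappa>: "0 < \<kappa>"
    and ev: "eventually (\<lambda>x. \<forall>u \<omega>. 0 < u \<and> \<epsilon> < \<bar>ln u\<bar> \<and> \<bar>ln u\<bar> < \<epsilon>' \<and> G \<omega> \<longrightarrow>
       \<kappa> \<le> \<bar>\<phi> (\<omega> * ((h x - of_real u powr k * h (u * x)) / of_real (norm (h x))))\<bar>) F"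
  shows False
proof -
  obtain \<sigma> :: real where \<sigma>: "\<sigma> \<in> {-1, 1}"
    and FE: "\<And>P. eventually P F \<Longrightarrow> \<exists>x0>0. \<forall>x. 0 < x \<and> x < x0 \<longrightarrow> P (\<sigma> * x)"
  proof (cases "F = at_right 0")
    case True
    show ?thesis by (rule that[of 1]) (auto simp: True eventually_at_right_field)
  next
    case False
    then have Fl: "F = at_left 0" using F by simp
    have "\<exists>x0>0. \<forall>x. 0 < x \<and> x < x0 \<longrightarrow> P (- 1 * x)" if P: "eventually P F" for P
    proof -
      obtain b where b: "b < 0" "\<And>y. b < y \<Longrightarrow> y < 0 \<Longrightarrow> P y"
        using P unfolding Fl eventually_at_left_field by blast
      show ?thesis by (rule exI[of _ "- b"]) (use b in auto)
    qed
    then show ?thesis by (intro that[of "-1"]) simp_all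
  qed
  obtain x0 where x0: "0 < x0" and
    big: "\<And>x u \<omega>. 0 < x \<Longrightarrow> x < x0 \<Longrightarrow> 0 < u \<Longrightarrow> \<epsilon> < \<bar>ln u\<bar> \<Longrightarrow> \<bar>ln u\<bar> < \<epsilon>' \<Longrightarrow> G \<omega> \<Longrightarrow>
       \<kappa> \<le> \<bar>\<phi> (\<omega> * ((h (\<sigma> * x) - of_real u powr k * h (u * (\<sigma> * x))) / of_real (norm (h (\<sigma> * x)))))\<bar>"
    using FE[OF ev] by blast
  show False
  proof (rule no_unbounded[OF G \<sigma> \<epsilon> \<kappa> x0])
    fix x u \<omega> assume a: "0 < x" "x < x0" "0 < u" "\<epsilon> < \<bar>ln u\<bar>" "\<bar>ln u\<bar> < \<epsilon>'" "G \<omega>"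
    let ?n = "norm (h (\<sigma> * x))" and ?A = "h (\<sigma> * x) - of_real u powr k * h (u * (\<sigma> * x))"
    have "\<omega> * (?A / of_real ?n) = of_real (1 / ?n) * (\<omega> * ?A)" by simp
    then have "\<kappa> \<le> \<bar>(1 / ?n) * \<phi> (\<omega> * ?A)\<bar>" using big[OF a] by (simp only: \<phi>_of_real_mult)
    \<comment> \<open>Division by zero yields 0, so \<kappa> > 0 excludes
      \<open>?n = 0\<close>.\<close>
    then have "?n \<noteq> 0 \<and> \<kappa> \<le> \<bar>\<phi> (\<omega> * ?A)\<bar> / ?n" using \<kappa> by (auto simp: abs_mult)
    then show "\<kappa> * ?n \<le> \<bar>\<phi> (\<omega> * ?A)\<bar>" by (auto simp: pos_le_divide_eq)
  next
    fix B
    show "\<exists>x1>0. \<forall>x. 0 < x \<and> x < x1 \<longrightarrow> B \<le> norm (h (\<sigma> * x))"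
      using top unfolding filterlim_at_top by (intro FE) blast
  qed
qed

lemma no_singular_real:
  assumes top: "filterlim (\<lambda>x. norm (h x)) at_top F"
    and F: "F = at_right (0::real) \<or> F = at_left 0"
    and k: "Im k = 0" and e0: "0 < \<epsilon>0"
    and lim: "\<forall>\<epsilon>. 0 < \<epsilon> \<and> \<epsilon> < \<epsilon>0 \<longrightarrow> Liminf F (\<lambda>x. INF u\<in>{u::real. u > 0 \<and> \<epsilon> < \<bar>ln u\<bar> \<and> \<bar>ln u\<bar> < \<epsilon> powr (2/3)}.
                        ereal \<bar>\<phi> (\<theta> powi p * ((h x - (of_real u) powr k * h (u * x)) / of_real (norm (h x))))\<bar>) > 0" (is "\<forall>\<epsilon>. _ \<longrightarrow> Liminf F (?X \<epsilon>) > 0")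
  shows False
proof -
  obtain \<epsilon> where \<epsilon>: "0 < \<epsilon>" "\<epsilon> < \<epsilon>0" "\<epsilon> < \<epsilon> powr (2/3)" "\<epsilon> powr (2/3) \<le> 1"
    using exists_small_less_powr[OF e0] by blast
  then have "Liminf F (?X \<epsilon>) > 0" using lim by blast
  then obtain \<kappa> where \<kappa>: "0 < \<kappa>" and ev: "eventually (\<lambda>x. ereal \<kappa> < ?X \<epsilon> x) F"
    using eventually_gt_of_Liminf_pos by blast
  show False
  proof (rule no_singular[OF F top \<epsilon>(1,3,4) steerable_root[OF k, of p] \<kappa>], rule eventually_mono[OF ev], intro allI impI)
    fix x u \<omega>
    assume lt: "ereal \<kappa> < ?X \<epsilon> x"
      and u: "0 < u \<and> \<epsilon> < \<bar>ln u\<bar> \<and> \<bar>ln u\<bar> < \<epsilon> powr (2/3) \<and> \<omega> = \<theta> powi p"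
    have "?X \<epsilon> x \<le> ereal \<bar>\<phi> (\<theta> powi p * ((h x - (of_real u) powr k * h (u * x)) / of_real (norm (h x))))\<bar>"
      by (rule INF_lower) (use u in auto)
    from less_le_trans[OF lt this] u
    show "\<kappa> \<le> \<bar>\<phi> (\<omega> * ((h x - of_real u powr k * h (u * x)) / of_real (norm (h x))))\<bar>" by simp
  qed
qed

lemma no_singular_nonreal:
  assumes top: "filterlim (\<lambda>x. norm (h x)) at_top F"
    and F: "F = at_right (0::real) \<or> F = at_left 0"
    and k: "Im k \<noteq> 0" and e0: "0 < \<epsilon>0"
    and lim: "\<forall>\<epsilon>. 0 < \<epsilon> \<and> \<epsilon> < \<epsilon>0 \<longrightarrow> Liminf F (\<lambda>x. Inf {ereal \<bar>\<phi> (e1 \<alpha> * ((h x - (of_real u) powr k * h (u * x)) / of_real (norm (h x))))\<bar> |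
                          (u::real) (\<alpha>::real). u > 0 \<and> \<epsilon> < \<bar>ln u\<bar> \<and>
                          \<bar>ln u\<bar> < \<epsilon> powr (2/3) \<and> \<bar>\<alpha> - \<beta>\<bar> < \<epsilon> powr (2/3)}) > 0" (is "\<forall>\<epsilon>. _ \<longrightarrow> Liminf F (?X \<epsilon>) > 0")
  shows False
proof -
  obtain \<epsilon> where \<epsilon>: "0 < \<epsilon>" "\<epsilon> < \<epsilon>0" "\<epsilon> < \<epsilon> powr (2/3)" "\<epsilon> powr (2/3) \<le> 1"
    using exists_small_less_powr[OF e0] by blast
  then have "Liminf F (?X \<epsilon>) > 0" using lim by blast
  then obtain \<kappa> where \<kappa>: "0 < \<kappa>" and ev: "eventually (\<lambda>x. ereal \<kappa> < ?X \<epsilon> x) F"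
    using eventually_gt_of_Liminf_pos by blast
  have \<tau>: "0 < \<epsilon> powr (2/3)" using \<epsilon> by simp
  show False
  proof (rule no_singular[OF F top \<epsilon>(1,3,4) steerable_phase[OF k \<tau>, of \<beta>] \<kappa>], rule eventually_mono[OF ev],
      intro allI impI, elim conjE exE)
    fix x u \<omega> \<alpha>
    assume lt: "ereal \<kappa> < ?X \<epsilon> x"
      and u: "0 < u" "\<epsilon> < \<bar>ln u\<bar>" "\<bar>ln u\<bar> < \<epsilon> powr (2/3)" "\<bar>\<alpha> - \<beta>\<bar> < \<epsilon> powr (2/3)" "\<omega> = cis (2 * pi * \<alpha>)"
    have "?X \<epsilon> x \<le> ereal \<bar>\<phi> (e1 \<alpha> * ((h x - (of_real u) powr k * h (u * x)) / of_real (norm (h x))))\<bar>"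
      by (rule Inf_lower) (use u in blast)
    from less_le_trans[OF lt this] u(5)
    show "\<kappa> \<le> \<bar>\<phi> (\<omega> * ((h x - of_real u powr k * h (u * x)) / of_real (norm (h x))))\<bar>" by (simp add: e1_eq_cis)
  qed
qed

end

section \<open>Measurability of the limit\<close>

text \<open>Only finitely many digits enter, and any function on the discrete space of words is
  measurable, whatever \<open>f\<close> is.\<close>

lemma fstar_seq_borel: "(\<lambda>x. fstar_seq f \<theta> k x j) \<in> borel_measurable borel"
proof -
  define n where "n = 2 * j + 1"
  define Z where "Z w = \<theta> powi (-3 - (\<Sum>i=1..n. (-1)^i * (w ! (i - 1))))
     * (of_int (rden (cf_val w 0)) :: complex) powr (-k) * f (rbar (cf_val w 0))" for w
  have "fstar_seq f \<theta> k x j = Z (cf_prefix (dig x) n)" for x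
  proof -
    have "(\<Sum>i=1..n. (-1)^i * (cf_prefix (dig x) n ! (i - 1))) = (\<Sum>i=1..n. (-1)^i * cf_digit x i)"
    proof (rule sum.cong)
      fix i assume "i \<in> {1..n}"
      then have "cf_prefix (dig x) n ! (i - 1) = cf_digit x i"
        unfolding cf_prefix_def by (subst nth_map) (auto simp: dig_def)
      then show "(-1)^i * (cf_prefix (dig x) n ! (i - 1)) = (-1)^i * cf_digit x i" by simp
    qed simp
    moreover have "cf_conv x n = cf_val (cf_prefix (dig x) n) 0"
      by (rule cf_conv_eq)
    ultimately show ?thesis unfolding fstar_seq_def Z_def n_def[symmetric] by simp
  qed
  moreover have "(\<lambda>x. Z (cf_prefix (dig x) n)) \<in> borel_measurable borel"
    by (rule measurable_compose[OF cf_prefix_dig_borel]) simp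
  ultimately show ?thesis by simp
qed

lemma fstar_borel: "fstar f \<theta> k \<in> borel_measurable borel"
proof -
  note [measurable] = fstar_seq_borel
  have "{x \<in> space borel. convergent (fstar_seq f \<theta> k x)} \<in> sets borel"
    unfolding Cauchy_convergent_iff[symmetric] by measurable
  then show ?thesis unfolding fstar_def[abs_def]
    by (intro measurable_If borel_measurable_lim_metric fstar_seq_borel borel_measurable_const) auto
qed

section \<open>The limit at points with a prescribed prefix\<close>

context reciprocity
begin

text \<open>The digits of \<open>cf_val v z\<close> are \<open>v\<close> followed by those of z, so
  the series splits at \<open>v\<close>; the defining limit is taken along its partial sums of odd
  length.\<close>

lemma fstar_seq_tendsto:
  assumes v: "word v" and z: "z \<in> irr"
    and r: "(\<lambda>n. psum \<theta> k h ((-1) ^ length v) (cf_rev v 0) (cf_prefix (dig z) n)) \<longlonglongrightarrow> r"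
  shows "fstar_seq f \<theta> k (cf_val v z) \<longlonglongrightarrow> f 0 + (psum \<theta> k h 1 0 v + coef \<theta> k 1 0 v * r)"
proof -
  let ?x = "cf_val v z"
  have x: "?x \<in> irr" by (rule cf_val_irr[OF z v])
  have "psum \<theta> k h 1 0 (cf_prefix (dig ?x) (n + length v)) = psum \<theta> k h 1 0 v
      + coef \<theta> k 1 0 v * psum \<theta> k h ((-1) ^ length v) (cf_rev v 0) (cf_prefix (dig z) n)" for n
    using psum_append[OF \<theta>_nz v word_dig[OF z], of 0 k h 1 n] dig_cf_val[OF z v, of n]
    by (simp add: add.commute[of n])
  then have "(\<lambda>n. psum \<theta> k h 1 0 (cf_prefix (dig ?x) (n + length v))) \<longlonglongrightarrow> psum \<theta> k h 1 0 v + coef \<theta> k 1 0 v * r"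
    using r by (simp only: tendsto_intros)
  then have "(\<lambda>n. psum \<theta> k h 1 0 (cf_prefix (dig ?x) n)) \<longlonglongrightarrow> psum \<theta> k h 1 0 v + coef \<theta> k 1 0 v * r"
    by (rule LIMSEQ_offset)
  then have "((\<lambda>n. psum \<theta> k h 1 0 (cf_prefix (dig ?x) n)) \<circ> (\<lambda>j. 2 * j + 1)) \<longlonglongrightarrow> psum \<theta> k h 1 0 v + coef \<theta> k 1 0 v * r"
    by (rule LIMSEQ_subseq_LIMSEQ) (simp add: strict_mono_def)
  then have "(\<lambda>j. f 0 + psum \<theta> k h 1 0 (cf_prefix (dig ?x) (2 * j + 1))) \<longlonglongrightarrow> f 0 + (psum \<theta> k h 1 0 v + coef \<theta> k 1 0 v * r)"
    unfolding o_def by (intro tendsto_add tendsto_const)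
  then show ?thesis unfolding fstar_seq_eq_psum[OF x, symmetric] .
qed

lemma fstar_eqI: "fstar_seq f \<theta> k x \<longlonglongrightarrow> l \<Longrightarrow> fstar f \<theta> k x = l"
  by (auto simp: fstar_def convergent_def limI)

end

text \<open>A continuous extension is bounded, so there \<delta> = 1/2 is an arbitrary choice.
  \<open>A\<close>, \<open>B\<close> and \<open>T\<close> match the remaining conjuncts of the two
  alternatives.\<close>

lemma growth_bound:
  fixes h :: "real \<Rightarrow> complex" and A :: "(real \<Rightarrow> complex) \<Rightarrow> bool" and B :: "real filter \<Rightarrow> bool" and T :: "real filter \<Rightarrow> bool"
  assumes "(\<exists>g. continuous_on {-1..1} g \<and> (\<forall>x\<in>{-1..1}. x \<noteq> 0 \<longrightarrow> g x = h x) \<and> A g) \<or>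
    (\<exists>F. (F = at_right (0::real) \<or> F = at_left 0) \<and> T F \<and>
      (\<exists>\<delta>\<in>{0<..<1}. \<exists>C. \<forall>x::real. 0 < \<bar>x\<bar> \<and> \<bar>x\<bar> \<le> 1 \<longrightarrow> norm (h x) \<le> C * exp (\<bar>x\<bar> powr (-1 + \<delta>))) \<and> B F)"
  shows "\<exists>\<delta>\<in>{0<..<1}. \<exists>C. \<forall>x::real. 0 < \<bar>x\<bar> \<and> \<bar>x\<bar> \<le> 1 \<longrightarrow> norm (h x) \<le> C * exp (\<bar>x\<bar> powr (-1 + \<delta>))"
  using assms
proof (elim disjE exE conjE)
  fix g assume g: "continuous_on {-1..1} g" "\<forall>x\<in>{-1..1}. x \<noteq> 0 \<longrightarrow> g x = h x"
  have "bounded (g ` {-1..1})" using g(1) by (intro compact_imp_bounded compact_continuous_image) auto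
  then obtain H where H: "\<And>x. x \<in> {-1..1} \<Longrightarrow> norm (g x) \<le> H" unfolding bounded_iff by blast
  have H0: "0 \<le> H" using order_trans[OF norm_ge_zero H[of 0]] by simp
  have "norm (h x) \<le> H * exp (\<bar>x\<bar> powr (-1 + 1/2))" if "0 < \<bar>x\<bar>" "\<bar>x\<bar> \<le> 1" for x
  proof -
    have "x \<in> {-1..1}" "x \<noteq> 0" using that by auto
    then have "norm (h x) \<le> H * 1" using H g(2) by (metis mult.right_neutral)
    also have "\<dots> \<le> H * exp (\<bar>x\<bar> powr (-1 + 1/2))" using H0 by (intro mult_left_mono) auto
    finally show ?thesis .
  qed
  then show ?thesis by (intro bexI[of _ "1/2"] exI[of _ H]) auto
qed auto

text \<open>Evaluating \<open>g\<close> rather than \<open>h\<close> admits \<alpha> = 0. Excluding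
  \<phi> = 0 matters for nonreal k in the continuous case: the condition on \<open>g\<close> does
  not involve \<phi>, and the zero form would give an atom at 0.\<close>

theorem theorem3p5:
  fixes k \<theta> :: complex and f :: "rat \<Rightarrow> complex" and h :: "real \<Rightarrow> complex"
    and \<phi> :: "complex \<Rightarrow> real"
  assumes k_pos: "Re k > 0"
    and root: "\<exists>n::nat. n > 0 \<and> \<theta> ^ n = 1"
    and f_per: "\<forall>x::rat. f (x + 1) = \<theta> * f x"
    and h_pos: "\<forall>x::rat. x > 0 \<longrightarrow>
        h (of_rat x) = f x - \<theta> ^ 3 * (of_real \<bar>of_rat x\<bar> :: complex) powr (-k) * f (-1/x)"
    and h_neg: "\<forall>x::rat. x < 0 \<longrightarrow>
        h (of_rat x) = f x - \<theta> powi (-3) * (of_real \<bar>of_rat x\<bar> :: complex) powr (-k) * f (-1/x)"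
    and \<phi>_lin: "linear \<phi>"
    and \<phi>_nz: "\<phi> \<noteq> (\<lambda>_. 0)"
    and hyp: "(\<exists>g :: real \<Rightarrow> complex.
                 continuous_on {-1..1} g \<and> (\<forall>x\<in>{-1..1}. x \<noteq> 0 \<longrightarrow> g x = h x) \<and>
                 ((Im k = 0 \<and> (\<exists>p::int. \<exists>\<alpha>\<in>{-1<..<1}. \<phi> (\<theta> powi p * g \<alpha>) \<noteq> 0)) \<or>
                  (Im k \<noteq> 0 \<and> (\<exists>\<alpha>\<in>{-1<..<1}. g \<alpha> \<noteq> 0))))
            \<or>
            (\<exists>F. (F = at_right (0::real) \<or> F = at_left 0) \<and>
                 filterlim (\<lambda>x. norm (h x)) at_top F \<and>
                 (\<exists>\<delta>\<in>{0<..<1}. \<exists>C. \<forall>x::real. 0 < \<bar>x\<bar> \<and> \<bar>x\<bar> \<le> 1 \<longrightarrow>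
                     norm (h x) \<le> C * exp (\<bar>x\<bar> powr (-1 + \<delta>))) \<and>
                 ((Im k = 0 \<and> (\<exists>p::int. \<exists>\<epsilon>0>0. \<forall>\<epsilon>. 0 < \<epsilon> \<and> \<epsilon> < \<epsilon>0 \<longrightarrow>
                     Liminf F (\<lambda>x. INF u\<in>{u::real. u > 0 \<and> \<epsilon> < \<bar>ln u\<bar> \<and> \<bar>ln u\<bar> < \<epsilon> powr (2/3)}.
                        ereal \<bar>\<phi> (\<theta> powi p * ((h x - (of_real u) powr k * h (u * x)) / of_real (norm (h x))))\<bar>) > 0))
                  \<or>
                  (Im k \<noteq> 0 \<and> (\<exists>\<beta>::real. \<exists>\<epsilon>0>0. \<forall>\<epsilon>. 0 < \<epsilon> \<and> \<epsilon> < \<epsilon>0 \<longrightarrow>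
                     Liminf F (\<lambda>x. Inf {ereal \<bar>\<phi> (e1 \<alpha> * ((h x - (of_real u) powr k * h (u * x)) / of_real (norm (h x))))\<bar> |
                          (u::real) (\<alpha>::real). u > 0 \<and> \<epsilon> < \<bar>ln u\<bar> \<and>
                          \<bar>ln u\<bar> < \<epsilon> powr (2/3) \<and> \<bar>\<alpha> - \<beta>\<bar> < \<epsilon> powr (2/3)}) > 0))))"
  shows "(AE x in lborel. 0 < x \<and> x < 1 \<and> x \<notin> \<rat> \<longrightarrow> convergent (fstar_seq f \<theta> k x))
       \<and> (\<lambda>x. \<phi> (fstar f \<theta> k x)) \<in> borel_measurable (restrict_space lebesgue {0..1})
       \<and> continuous_on UNIV
           (cdf (distr (restrict_space lebesgue {0..1}) borel (\<lambda>x. \<phi> (fstar f \<theta> k x))))"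
proof -
  obtain N :: nat where N: "0 < N" "\<theta> ^ N = 1" using root by blast
  have \<theta>_norm: "norm \<theta> = 1"
    using N by (metis norm_ge_zero norm_one norm_power power_eq_1_iff gr_implies_not0)
  interpret reciprocity k \<theta> f h
    using k_pos \<theta>_norm f_per h_pos h_neg by unfold_locales auto
  obtain \<delta> C where \<delta>: "0 < \<delta>" "\<delta> < 1"
    and bound: "\<And>x. 0 < \<bar>x\<bar> \<Longrightarrow> \<bar>x\<bar> \<le> 1 \<Longrightarrow> norm (h x) \<le> C * exp (\<bar>x\<bar> powr (- 1 + \<delta>))"
    using growth_bound[OF hyp] by (metis greaterThanLessThan_iff)
  have tails: "\<exists>M. \<forall>z\<in>slow (1 + \<delta>) K. \<forall>y\<in>{0..1}. \<forall>e\<in>{-1, 1}. \<exists>r. norm r \<le> M \<and>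
      (\<lambda>n. psum \<theta> k h e y (cf_prefix (dig z) n)) \<longlonglongrightarrow> r" if "0 < K" for K
    by (rule tails_converge_boundedly[OF k_pos \<theta>_norm \<delta> that bound])
  obtain C0 where C0: "\<And>K. 0 < K \<Longrightarrow> measure lebesgue (irr - slow (1 + \<delta>) K) \<le> C0 / K"
    using measure_not_slow[of "1 + \<delta>"] \<delta> by auto
  have conv: "convergent (fstar_seq f \<theta> k x)" if x: "x \<in> slow (1 + \<delta>) K" and K: "0 < K" for x K
  proof -
    obtain r where "(\<lambda>n. psum \<theta> k h 1 0 (cf_prefix (dig x) n)) \<longlonglongrightarrow> r"
    proof -
      have "(0::real) \<in> {0..1}" "(1::int) \<in> {-1, 1}" by auto
      then show ?thesis using tails[OF K] x that by blast
    qed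
    then show ?thesis using fstar_seq_tendsto[of "[]" x r] slow_subset x by (auto simp: convergent_def)
  qed
  \<comment> \<open>Contained in each complement of a slow set, so of measure at most C0/(n + 1) for
    every n.\<close>
  define Z where "Z = (\<Inter>n. irr - slow (1 + \<delta>) (real (Suc n)))"
  have Zb: "Z \<in> sets borel" unfolding Z_def by (intro sets.countable_INT'' sets.Diff irr_borel slow_borel) auto
  have Zi: "Z \<subseteq> irr" by (auto simp: Z_def)
  have "measure lebesgue Z \<le> C0 / real (Suc n)" for n
  proof -
    have "measure lebesgue Z \<le> measure lebesgue (irr - slow (1 + \<delta>) (real (Suc n)))"
    proof (rule measure_mono_fmeasurable)
      show "irr - slow (1 + \<delta>) (real (Suc n)) \<in> lmeasurable"
        by (intro irr_lmeasurable sets.Diff irr_borel slow_borel) auto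
    qed (use Zb in \<open>auto simp: Z_def\<close>)
    also have "\<dots> \<le> C0 / real (Suc n)" by (rule C0) simp
    finally show ?thesis .
  qed
  moreover have "(\<lambda>n. C0 / real (Suc n)) \<longlonglongrightarrow> 0"
    using LIMSEQ_Suc[OF lim_const_over_n[of C0]] by simp
  ultimately have "measure lebesgue Z \<le> 0" by (intro LIMSEQ_le_const) auto
  then have "measure lebesgue Z = 0" by (simp add: measure_le_0_iff)
  then have "emeasure lebesgue Z = 0" using emeasure_eq_measure2[OF irr_lmeasurable[OF Zb Zi]] by simp
  then have Zn: "Z \<in> null_sets lborel" using Zb by (auto simp: null_sets_def)
  have ae: "AE x in lborel. 0 < x \<and> x < 1 \<and> x \<notin> \<rat> \<longrightarrow> convergent (fstar_seq f \<theta> k x)"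
  proof (rule AE_I'[OF Zn], rule subsetI)
    fix x assume "x \<in> {x \<in> space lborel. \<not> (0 < x \<and> x < 1 \<and> x \<notin> \<rat> \<longrightarrow> convergent (fstar_seq f \<theta> k x))}"
    then have "x \<in> irr" "\<not> convergent (fstar_seq f \<theta> k x)" by (auto simp: irr_def)
    then show "x \<in> Z" using conv by (auto simp: Z_def)
  qed
  define \<Phi> where "\<Phi> x = \<phi> (fstar f \<theta> k x)" for x
  have "continuous_on UNIV \<phi>" using \<phi>_lin by (rule linear_continuous_on_compose[OF continuous_on_id])
  then have \<Phi>b: "\<Phi> \<in> borel_measurable borel" unfolding \<Phi>_def
    by (intro measurable_compose[OF fstar_borel] borel_measurable_continuous_onI)
  then have \<Phi>m: "\<Phi> \<in> borel_measurable (restrict_space lebesgue {0..1})"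
    by (intro measurable_restrict_space1 measurable_completion) simp
  define E where "E t = {x \<in> irr. \<Phi> x = t}" for t
  have E: "E t \<in> sets borel" "E t \<subseteq> irr" for t
  proof -
    have "E t = irr \<inter> (\<Phi> -` {t} \<inter> space borel)" by (auto simp: E_def)
    also have "\<dots> \<in> sets borel" by (intro sets.Int irr_borel measurable_sets[OF \<Phi>b]) auto
    finally show "E t \<in> sets borel" .
  qed (auto simp: E_def)
  have level: "measure lebesgue (E t) = 0" for t
  proof (rule ccontr)
    assume "measure lebesgue (E t) \<noteq> 0"
    then have Epos: "0 < measure lebesgue (E t)" by (simp add: zero_less_measure_iff)
    \<comment> \<open>Makes C0/K < 1, so that the slow set has positive measure.\<close>
    define K where "K = \<bar>C0\<bar> + 1"
    have K: "0 < K" by (simp add: K_def)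
    define B where "B = slow (1 + \<delta>) K"
    have B: "B \<in> sets borel" "B \<subseteq> irr" unfolding B_def by (rule slow_borel slow_subset)+
    have "measure lebesgue (irr - B) = measure lebesgue irr - measure lebesgue B"
      by (rule measurable_measure_Diff) (use B irr_lmeasurable irr_borel in auto)
    moreover have "measure lebesgue (irr - B) \<le> C0 / K" unfolding B_def by (rule C0[OF K])
    moreover have "C0 / K < 1" by (simp add: K_def)
    ultimately have Bpos: "0 < measure lebesgue B" using measure_irr by simp
    obtain M where M: "\<And>z y e. z \<in> B \<Longrightarrow> y \<in> {0..1} \<Longrightarrow> e \<in> {-1, 1} \<Longrightarrow> \<exists>r. norm r \<le> M \<and>
        (\<lambda>n. psum \<theta> k h e y (cf_prefix (dig z) n)) \<longlonglongrightarrow> r"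
      using tails[OF K] unfolding B_def by blast
    \<comment> \<open>The level is shifted by the constant f(0), which stands outside the
      series.\<close>
    interpret level_set k \<theta> h \<phi> M "t - \<phi> (f 0)" N
    proof (rule level_set.intro)
      fix W :: "int list set" assume W: "finite W" "\<And>w. w \<in> W \<Longrightarrow> word w"
      obtain u where u: "word u" "\<And>w. w \<in> W \<Longrightarrow> \<exists>z\<in>B. cf_val (u @ w) z \<in> E t"
        using positive_set_meets_extensions[OF E Epos B Bpos W] by blast
      have "\<exists>r. norm r \<le> M \<and> \<phi> (psum \<theta> k h 1 0 (u @ w) + coef \<theta> k 1 0 (u @ w) * r) = t - \<phi> (f 0)"
        if w: "w \<in> W" for w
      proof -
        obtain z where z: "z \<in> B" "cf_val (u @ w) z \<in> E t" using u(2)[OF w] by blast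
        have v: "word (u @ w)" using u(1) W(2)[OF w] by simp
        have y: "cf_rev (u @ w) 0 \<in> {0..1::real}" using cf_rev_unit[OF v, of 0] by simp
        have e: "(-1) ^ length (u @ w) \<in> {-1, 1::int}" by (cases "even (length (u @ w))") auto
        obtain r where r: "norm r \<le> M"
          "(\<lambda>n. psum \<theta> k h ((-1) ^ length (u @ w)) (cf_rev (u @ w) 0) (cf_prefix (dig z) n)) \<longlonglongrightarrow> r"
          using M[OF z(1) y e] by blast
        have "fstar f \<theta> k (cf_val (u @ w) z) = f 0 + (psum \<theta> k h 1 0 (u @ w) + coef \<theta> k 1 0 (u @ w) * r)"
          using z(1) B(2) by (intro fstar_eqI fstar_seq_tendsto v r) auto
        then have "\<phi> (f 0 + (psum \<theta> k h 1 0 (u @ w) + coef \<theta> k 1 0 (u @ w) * r)) = t"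
          using z(2) by (simp only: E_def \<Phi>_def mem_Collect_eq)
        then show ?thesis using r(1) by (auto simp: linear_add[OF \<phi>_lin])
      qed
      then show "\<exists>u. word u \<and> (\<forall>w\<in>W. \<exists>r. norm r \<le> M \<and> \<phi> (psum \<theta> k h 1 0 (u @ w) + coef \<theta> k 1 0 (u @ w) * r) = t - \<phi> (f 0))"
        using u(1) by blast
    qed (use k_pos N \<phi>_lin in auto)
    from hyp show False
    proof (elim disjE exE conjE bexE)
      fix g p \<alpha>
      assume "continuous_on {-1..1} g" "\<forall>x\<in>{-1..1}. x \<noteq> 0 \<longrightarrow> g x = h x" "Im k = 0"
        "\<alpha> \<in> {-1<..<1}" "\<phi> (\<theta> powi p * g \<alpha>) \<noteq> 0"
      then show False by (intro no_continuous_real[of g \<alpha> p]) blast+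
    next
      fix g \<alpha>
      assume "continuous_on {-1..1} g" "\<forall>x\<in>{-1..1}. x \<noteq> 0 \<longrightarrow> g x = h x" "Im k \<noteq> 0"
        "\<alpha> \<in> {-1<..<1}" "g \<alpha> \<noteq> 0"
      then show False using \<phi>_nz by (intro no_continuous_nonreal[of g \<alpha>]) blast+
    qed (blast intro: no_singular_real no_singular_nonreal)+
  qed
  let ?\<mu> = "restrict_space lebesgue {0..1::real}"
  have "prob_space ?\<mu>"
    by (rule prob_spaceI) (simp add: emeasure_restrict_space space_restrict_space)
  then interpret D: real_distribution "distr ?\<mu> borel \<Phi>"
    using \<Phi>m by (intro prob_space.real_distribution_distr)
  \<comment> \<open>Continuity at t means that t is not an atom; the points of [0,1] outside
    \<open>irr\<close> form a null set.\<close>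
  have "isCont (cdf (distr ?\<mu> borel \<Phi>)) t" for t
  proof -
    have "emeasure lebesgue (E t) = 0"
      using level[of t] emeasure_eq_measure2[OF irr_lmeasurable[OF E, of t]] by simp
    then have "E t \<in> null_sets lborel" using E(1) by (auto simp: null_sets_def)
    moreover have "\<rat> \<in> null_sets lborel" "{0, 1::real} \<in> null_sets lborel"
      by (auto intro: countable_imp_null_set_lborel countable_rat)
    ultimately have "E t \<union> (\<rat> \<union> {0, 1}) \<in> null_sets lborel" by (intro null_sets.Un)
    then have "E t \<union> (\<rat> \<union> {0, 1}) \<in> null_sets lebesgue" by (rule null_sets_completionI)
    moreover have "\<Phi> -` {t} \<inter> {0..1} \<subseteq> E t \<union> (\<rat> \<union> {0, 1})" by (auto simp: E_def irr_def)
    moreover have S: "\<Phi> -` {t} \<inter> {0..1} \<in> sets lebesgue"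
    proof -
      have "\<Phi> -` {t} \<inter> space borel \<in> sets borel" by (rule measurable_sets[OF \<Phi>b]) simp
      then show ?thesis by (auto intro!: sets.Int)
    qed
    ultimately have "\<Phi> -` {t} \<inter> {0..1} \<in> null_sets lebesgue" by (meson null_sets_subset)
    then have "measure lebesgue (\<Phi> -` {t} \<inter> {0..1}) = 0" by (simp add: measure_eq_0_null_sets)
    then have "measure (distr ?\<mu> borel \<Phi>) {t} = 0"
      using \<Phi>m S by (simp add: measure_distr measure_restrict_space space_restrict_space)
    then show ?thesis by (simp add: D.isCont_cdf)
  qed
  then have "continuous_on UNIV (cdf (distr ?\<mu> borel \<Phi>))"
    by (simp add: continuous_on_eq_continuous_at)
  then show ?thesis using ae \<Phi>m unfolding \<Phi>_def by blast
qed

end
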